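(* Let $\psi\in\mathfrak M^+_\infty$, $\beta\in\mathbb R$, $1\le p\le\infty$. Then for every $n\in\mathbb N$ such that $\eta(n)-n\ge a>2$ and $\mu(n)\ge b>2$, $$C_a\,\psi(n)(\eta(n)-n)^{1/p}\le E_n(C^\psi_{\beta,p})_C\le C^*_{a,b}\,\psi(n)(\eta(n)-n)^{1/p},$$ where $$C_a=\frac{\pi}{96(1+\pi^2)^2}\,\frac{(a-1)^2(a-2)^2}{a^3(3a-4)},\qquad C^*_{a,b}=\frac{2(1+\pi^2)}{\pi}\Big(\frac{2b}{b-2}+\frac{a}{a-1}\Big).$$
   Context: Let $\mathfrak M$ be the set of positive, continuous, convex-downward functions $\psi(t)$ of $t\ge1$ with $\lim_{t\to\infty}\psi(t)=0$. For $\psi\in\mathfrak M$ put $\eta(t)=\eta(\psi;t)=\psi^{-1}(\psi(t)/2)$, where $\psi^{-1}$ is the inverse function of $\psi$, and $\mu(t)=\mu(\psi;t)=t/(\eta(t)-t)$. Let $\mathfrak M^+_\infty$ be the set of $\psi\in\mathfrak M$ for which $\mu(\psi;t)$ increases monotonically to $\infty$ as $t\to\infty$. For $\beta\in\mathbb R$ let $\Psi_\beta$ be the summable $2\pi$-periodic function with Fourier series $\sum_{k=1}^\infty\psi(k)\cos(kt-\beta\pi/2)$. $C$ is the space of continuous $2\pi$-periodic functions with norm $\|f\|_C=\max_t|f(t)|$; $L_p$, $1\le p<\infty$, is the space of $2\pi$-periodic functions with $\|f\|_p=(\int_0^{2\pi}|f(t)|^pdt)^{1/p}<\infty$; $L_\infty$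 is the space of $2\pi$-periodic essentially bounded functions with $\|f\|_\infty=\operatorname{ess\,sup}_t|f(t)|$. Let $B^0_p=\{\varphi\in L_1:\ \|\varphi\|_p\le1,\ \int_0^{2\pi}\varphi=0\}$. $L^\psi_{\beta,p}$ ($1\le p\le\infty$) is the set of $2\pi$-periodic functions $f$ such that for almost every $x$, $f(x)=\frac{a_0}{2}+\frac1\pi\int_{-\pi}^{\pi}\Psi_\beta(x-t)\varphi(t)\,dt$ with $a_0\in\mathbb R$, $\varphi\in B^0_p$; $C^\psi_{\beta,p}$ is the subset of continuous functions in $L^\psi_{\beta,p}$. $\mathcal T_{2n-1}$ denotes the space of real trigonometric polynomials of degree at most $n-1$, and $E_n(C^\psi_{\beta,p})_C=\sup_{f\in C^\psi_{\beta,p}}\inf_{t_{n-1}\in\mathcal T_{2n-1}}\|f-t_{n-1}\|_C$. *)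

theory Defs
  imports "HOL-Analysis.Analysis"
begin

definition class_M :: "(real \<Rightarrow> real) \<Rightarrow> bool" where
  "class_M \<psi> \<longleftrightarrow> (\<forall>t\<ge>1. \<psi> t > 0) \<and> continuous_on {1..} \<psi> \<and>
     convex_on {1..} \<psi> \<and> (\<psi> \<longlongrightarrow> 0) at_top"

definition eta :: "(real \<Rightarrow> real) \<Rightarrow> real \<Rightarrow> real" where
  "eta \<psi> t = inv_into {1..} \<psi> (\<psi> t / 2)"

definition mu :: "(real \<Rightarrow> real) \<Rightarrow> real \<Rightarrow> real" where
  "mu \<psi> t = t / (eta \<psi> t - t)"

definition class_M_plus_inf :: "(real \<Rightarrow> real) \<Rightarrow> bool" where
  "class_M_plus_inf \<psi> \<longleftrightarrow> class_M \<psi> \<and> mono_on {1..} (mu \<psi>) \<and>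
     filterlim (mu \<psi>) at_top at_top"

definition Psi :: "(real \<Rightarrow> real) \<Rightarrow> real \<Rightarrow> real \<Rightarrow> real" where
  "Psi \<psi> \<beta> x = (\<Sum>k. \<psi> (real (Suc k)) * cos (real (Suc k) * x - \<beta> * pi / 2))"

definition periodic_2pi :: "(real \<Rightarrow> real) \<Rightarrow> bool" where
  "periodic_2pi f \<longleftrightarrow> (\<forall>x. f (x + 2 * pi) = f x)"

definition B0 :: "ereal \<Rightarrow> (real \<Rightarrow> real) set" where
  "B0 p = {\<phi>. periodic_2pi \<phi> \<and> \<phi> \<in> borel_measurable lborel \<and>
     set_integrable lborel {0..2*pi} \<phi> \<and> (LINT t:{0..2*pi}|lborel. \<phi> t) = 0 \<and>
     (if p = \<infinity> then (AE t in lborel. t \<in> {0..2*pi} \<longrightarrow> \<bar>\<phi> t\<bar> \<le> 1)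
      else set_integrable lborel {0..2*pi} (\<lambda>t. \<bar>\<phi> t\<bar> powr real_of_ereal p) \<and>
           (LINT t:{0..2*pi}|lborel. \<bar>\<phi> t\<bar> powr real_of_ereal p) powr (1 / real_of_ereal p) \<le> 1)}"

definition L_class :: "(real \<Rightarrow> real) \<Rightarrow> real \<Rightarrow> ereal \<Rightarrow> (real \<Rightarrow> real) set" where
  "L_class \<psi> \<beta> p = {f. periodic_2pi f \<and> (\<exists>a0::real. \<exists>\<phi>\<in>B0 p.
     AE x in lborel. f x = a0 / 2 + 1 / pi * (LINT t:{-pi..pi}|lborel. Psi \<psi> \<beta> (x - t) * \<phi> t))}"

definition C_class :: "(real \<Rightarrow> real) \<Rightarrow> real \<Rightarrow> ereal \<Rightarrow> (real \<Rightarrow> real) set" where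
  "C_class \<psi> \<beta> p = {f \<in> L_class \<psi> \<beta> p. continuous_on UNIV f}"

definition trig_polys :: "nat \<Rightarrow> (real \<Rightarrow> real) set" where
  "trig_polys n = {T. \<exists>a b :: nat \<Rightarrow> real. \<forall>x.
     T x = (\<Sum>k<n. a k * cos (real k * x) + b k * sin (real k * x))}"

definition E_approx :: "nat \<Rightarrow> (real \<Rightarrow> real) set \<Rightarrow> ereal" where
  "E_approx n K = (SUP f\<in>K. INF T\<in>trig_polys n. SUP x. ereal \<bar>f x - T x\<bar>)"

definition inv_p :: "ereal \<Rightarrow> real" where
  "inv_p p = (if p = \<infinity> then 0 else 1 / real_of_ereal p)"

definition C_low :: "real \<Rightarrow> real" where
  "C_low a = pi / (96 * (1 + pi\<^sup>2)\<^sup>2) * ((a - 1)\<^sup>2 * (a - 2)\<^sup>2 / (a ^ 3 * (3 * a - 4)))"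

definition C_up :: "real \<Rightarrow> real \<Rightarrow> real" where
  "C_up a b = 2 * (1 + pi\<^sup>2) / pi * (2 * b / (b - 2) + a / (a - 1))"

end

theory Submission
  imports Defs
begin

text \<open>Write \<open>m = eta \<psi> n - n\<close>. For the upper bound, subtracting a trigonometric polynomial of degree
  less than \<open>n\<close> replaces the kernel by one whose coefficients rise linearly from \<open>0\<close> to \<open>\<psi> n\<close> over a
  window of length about \<open>m\<close> below \<open>n\<close> and equal \<open>\<psi> k\<close> afterwards. Since \<open>mu \<psi>\<close> increases, \<open>\<psi>\<close>
  halves whenever its argument grows by the factor \<open>1 + m / n\<close>; hence the coefficients sum to
  \<open>O(m \<psi> n)\<close> and their second differences to \<open>O(\<psi> n / m)\<close>, so the new kernel is
  \<open>O(m \<psi> n / (1 + (m t)\<^sup>2))\<close> and Young's inequality gives the order \<open>\<psi> n * m powr (1 / p)\<close>.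
  For the lower bound, a Fejer kernel modulated to the frequencies between \<open>n\<close> and \<open>eta \<psi> n\<close>,
  where \<open>\<psi> \<ge> \<psi> n / 2\<close>, serves both as the density \<open>\<phi>\<close> and, phase shifted, as a functional
  annihilating the trigonometric polynomials of degree less than \<open>n\<close>.\<close>

subsection \<open>Convex functions with increasing characteristic\<close>

text \<open>Convexity cleared of its denominator \<open>z - x\<close>, so that values of
  \<open>\<psi>\<close> at the three points can be substituted without division.\<close>

lemma convex_three_points:
  fixes f :: "real \<Rightarrow> real"
  assumes "convex_on I f" "x \<in> I" "z \<in> I" "x < y" "y < z"
  shows "(z - x) * f y \<le> (z - y) * f x + (y - x) * f z"
proof -
  have "(1 - q) * x + q * z = x + q * (z - x)" for q by (simp add: algebra_simps)
  then have "(1 - (y - x) / (z - x)) * x + (y - x) / (z - x) * z = x + (y - x) / (z - x) * (z - x)" .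
  also have "\<dots> = y" using assms(4,5) by simp
  finally have y: "(1 - (y - x) / (z - x)) * x + (y - x) / (z - x) * z = y" .
  have z: "1 - (y - x) / (z - x) = (z - y) / (z - x)" using assms(4,5) by (simp add: field_simps)
  have "f y \<le> ((z - y) / (z - x)) * f x + ((y - x) / (z - x)) * f z"
    using convex_onD[OF assms(1), of "(y - x) / (z - x)" x z] assms
    unfolding real_scaleR_def y unfolding z by (simp add: y divide_le_eq)
  also have "\<dots> = ((z - y) * f x + (y - x) * f z) / (z - x)"
    by (simp add: add_divide_distrib)
  finally show ?thesis
    using assms(4,5) by (simp add: field_simps)
qed

text \<open>If \<open>\<psi> s \<le> \<psi> t\<close> held, convexity would keep
  \<open>\<psi>\<close> at or above the positive value \<open>\<psi> t\<close> everywhere to the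
  right of \<open>t\<close>, contradicting the limit 0.\<close>

lemma class_M_strict_antimono:
  assumes "class_M \<psi>" "1 \<le> s" "s < t"
  shows "\<psi> t < \<psi> s"
proof (rule ccontr)
  assume "\<not> \<psi> t < \<psi> s"
  then have le: "\<psi> s \<le> \<psi> t" by simp
  have cvx: "convex_on {1..} \<psi>" and lim: "(\<psi> \<longlongrightarrow> 0) at_top" and pos: "\<psi> t > 0"
    using assms by (auto simp: class_M_def)
  have "\<psi> t \<le> \<psi> u" if "u > t" for u
  proof -
    have "(u - s) * \<psi> t \<le> (u - t) * \<psi> s + (t - s) * \<psi> u"
      using convex_three_points[OF cvx, of s u t] assms that by auto
    also have "\<dots> \<le> (u - t) * \<psi> t + (t - s) * \<psi> u"
      using le that by (intro add_right_mono mult_left_mono) auto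
    finally have "(t - s) * \<psi> t \<le> (t - s) * \<psi> u"
      by (simp add: algebra_simps)
    then show ?thesis using assms by simp
  qed
  then have "\<psi> t \<le> 0"
    by (intro tendsto_lowerbound[OF lim] eventually_mono[OF eventually_gt_at_top[of t]]) auto
  with pos show False by simp
qed

lemma class_M_antimono:
  assumes "class_M \<psi>" "1 \<le> s" "s \<le> t"
  shows "\<psi> t \<le> \<psi> s"
  using class_M_strict_antimono[OF assms(1,2), of t] assms(3) by (cases "s = t") auto

lemma class_M_pos: "class_M \<psi> \<Longrightarrow> 1 \<le> t \<Longrightarrow> 0 < \<psi> t"
  by (simp add: class_M_def)

text \<open>\<open>eta\<close> is a choice made by \<open>inv_into\<close>, so its value is
  meaningful only once \<open>\<psi> t / 2\<close> is known to be attained on \<open>{1..}\<close>;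
  the limit 0 and the intermediate value theorem supply this.\<close>

lemma class_M_eta:
  assumes M: "class_M \<psi>" and t: "1 \<le> t"
  shows "\<psi> (eta \<psi> t) = \<psi> t / 2" "t < eta \<psi> t"
proof -
  have pos: "\<psi> t > 0" and cont: "continuous_on {1..} \<psi>" and lim: "(\<psi> \<longlongrightarrow> 0) at_top"
    using assms by (auto simp: class_M_def)
  have "eventually (\<lambda>x. \<psi> x < \<psi> t / 2) at_top"
    using order_tendstoD(2)[OF lim, of "\<psi> t / 2"] pos by simp
  then obtain u where u: "u \<ge> t" "\<psi> u < \<psi> t / 2"
    by (metis (mono_tags, lifting) eventually_at_top_linorder linorder_linear)
  have "continuous_on {t..u} \<psi>"
    using continuous_on_subset[OF cont] t by auto
  then obtain x where x: "x \<ge> t" "\<psi> x = \<psi> t / 2"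
    using IVT2'[of \<psi> u "\<psi> t / 2" t] u pos by auto
  then have "\<psi> t / 2 \<in> \<psi> ` {1..}" using t by (intro image_eqI[of _ _ x]) auto
  then show 1: "\<psi> (eta \<psi> t) = \<psi> t / 2" and "t < eta \<psi> t"
  proof -
    assume *: "\<psi> t / 2 \<in> \<psi> ` {1..}"
    show e: "\<psi> (eta \<psi> t) = \<psi> t / 2"
      unfolding eta_def using * by (rule f_inv_into_f)
    have "eta \<psi> t \<ge> 1"
      using inv_into_into[OF *] by (simp add: eta_def)
    then show "t < eta \<psi> t"
      using class_M_antimono[OF M, of "eta \<psi> t" t] e pos by (cases "t < eta \<psi> t") auto
  qed
qed

text \<open>\<open>r\<close> is the reciprocal of \<open>mu \<psi> n\<close>. The bounds
  \<open>a > 2\<close> and \<open>b > 2\<close> of the theorem enter here as \<open>2 < m\<close>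
  and \<open>r < 1 / 2\<close>.\<close>

locale psi_at =
  fixes \<psi> :: "real \<Rightarrow> real" and n :: nat and m r :: real
  assumes M: "class_M \<psi>" and mono: "mono_on {1..} (mu \<psi>)"
    and n: "1 \<le> n" and m: "m = eta \<psi> n - n" "2 < m"
    and r: "r = m / n" "r < 1 / 2"
begin

lemma n_pos: "0 < real n" using n by simp

lemma r_pos: "0 < r" using m r n_pos by simp

lemma pos: "1 \<le> t \<Longrightarrow> 0 < \<psi> t" using class_M_pos[OF M] .

lemma psi_nonneg: "real n \<le> t \<Longrightarrow> 0 \<le> \<psi> t" using pos[of t] n by simp

lemma antimono: "1 \<le> s \<Longrightarrow> s \<le> t \<Longrightarrow> \<psi> t \<le> \<psi> s" using class_M_antimono[OF M] .

lemma eta_n: "eta \<psi> n = n * (1 + r)" "eta \<psi> n = n + m"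
  using m r n_pos by (auto simp: field_simps)

text \<open>Monotonicity of \<open>mu\<close> between \<open>n\<close> and \<open>t\<close> reads
  \<open>n / m \<le> t / (eta \<psi> t - t)\<close>. Solving for \<open>eta \<psi> t\<close> gives
  one ratio \<open>1 + r\<close> that is valid for all \<open>t\<close>.\<close>

lemma eta_le:
  fixes t :: real assumes "t \<ge> n" shows "eta \<psi> t \<le> t * (1 + r)"
proof -
  have t: "t \<ge> 1" using assms n by simp
  then have gt: "eta \<psi> t > t" using class_M_eta[OF M] by simp
  have "mu \<psi> n \<le> mu \<psi> t"
    using mono_onD[OF mono] assms n by simp
  then have "n / m \<le> t / (eta \<psi> t - t)" by (simp add: mu_def m)
  then have "eta \<psi> t - t \<le> t * (m / n)"
    using gt m(2) n_pos by (simp add: field_simps)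
  then show ?thesis using r by (simp add: algebra_simps)
qed

lemma psi_half:
  fixes t :: real assumes "t \<ge> n" shows "\<psi> (t * (1 + r)) \<le> \<psi> t / 2"
proof -
  have t: "t \<ge> 1" using assms n by simp
  have "\<psi> (t * (1 + r)) \<le> \<psi> (eta \<psi> t)"
    using class_M_eta(2)[OF M t] t by (intro antimono eta_le assms) auto
  then show ?thesis using class_M_eta(1)[OF M t] by simp
qed

lemma psi_integrable: "1 \<le> s \<Longrightarrow> \<psi> integrable_on {s..t}"
  using M by (intro integrable_continuous_real) (auto simp: class_M_def intro: continuous_on_subset)

text \<open>A self-bounding estimate: the part of the integral beyond \<open>?q * n\<close> is
  rescaled by \<open>?q\<close> and halved by \<open>psi_half\<close>, so it is at most
  \<open>?q / 2\<close> times the original integral and can be absorbed on the left. The part before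
  \<open>?q * n\<close> has length \<open>m\<close>.\<close>

lemma integral_psi_le:
  fixes x :: real assumes "x \<ge> n" shows "integral {n..x} \<psi> \<le> 4 * m * \<psi> n"
proof -
  let ?q = "1 + r"
  have q: "?q > 1" "?q < 3/2" using r_pos r by auto
  have x: "x \<le> ?q * x" "n \<le> ?q * n" "?q * n \<le> ?q * x"
    using q n_pos assms by (auto simp: mult_le_cancel_right1)
  have "integral {n..x} \<psi> \<le> integral {n..?q * x} \<psi>"
    using x n by (intro integral_subset_le psi_integrable) (auto intro!: psi_nonneg)
  also have "\<dots> = integral {n..?q * n} \<psi> + integral {?q * n..?q * x} \<psi>"
    using x n by (intro Henstock_Kurzweil_Integration.integral_combine[symmetric] psi_integrable) auto
  also have "integral {n..?q * n} \<psi> \<le> m * \<psi> n"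
  proof -
    have "integral {n..?q * n} \<psi> \<le> integral {n..?q * n} (\<lambda>_. \<psi> n)"
      using n by (intro integral_le psi_integrable antimono) auto
    also have "\<dots> = (?q * n - n) * \<psi> n" using x(2) by simp
    also have "?q * n - n = m" using r n_pos by (simp add: field_simps)
    finally show ?thesis .
  qed
  also have "integral {?q * n..?q * x} \<psi> \<le> ?q / 2 * integral {n..x} \<psi>"
  proof -
    have im: "(\<lambda>x. x / ?q) ` {?q * n..?q * x} = {n..x}"
    proof -
      have "?q * n / ?q = n" "?q * x / ?q = x" using q by auto
      then show ?thesis
        using q x image_divide_atLeastAtMost[of ?q "?q * n" "?q * x"] by simp
    qed
    have int: "(\<lambda>s. \<psi> (?q * s)) integrable_on {n..x}"
      using integrable_stretch_real[OF psi_integrable, of "?q * n" ?q "?q * x"] x n q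
      by (simp add: im)
    have "integral {n..x} (\<lambda>s. \<psi> (?q * s)) = 1 / ?q * integral {?q * n..?q * x} \<psi>"
      using integral_stretch_real[of ?q "?q * n" "?q * x" \<psi>] q by (simp add: im)
    then have "integral {?q * n..?q * x} \<psi> = ?q * integral {n..x} (\<lambda>s. \<psi> (?q * s))"
      using q by simp
    also have "\<dots> \<le> ?q * integral {n..x} (\<lambda>s. \<psi> s / 2)"
      using q n psi_half
      by (intro mult_left_mono integral_le int integrable_on_divide psi_integrable)
         (auto simp: mult.commute)
    finally show ?thesis by simp
  qed
  finally have *: "(1 - ?q / 2) * integral {n..x} \<psi> \<le> m * \<psi> n"
    by (simp add: algebra_simps)
  have "integral {n..x} \<psi> \<ge> 0"
    using n by (intro integral_nonneg psi_integrable) (auto intro!: psi_nonneg)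
  \<comment> \<open>\<open>?q < 3 / 2\<close> leaves at least 1/4 after the absorption, which is the
    source of the factor 4.\<close>
  then have "1 / 4 * integral {n..x} \<psi> \<le> (1 - ?q / 2) * integral {n..x} \<psi>"
    using q by (intro mult_right_mono) auto
  with * show ?thesis by simp
qed

lemma sum_tail_le: "(\<Sum>k=n..<n+j. \<psi> (Suc k)) \<le> 4 * m * \<psi> n"
proof -
  have "(\<Sum>k=n..<n+j. \<psi> (Suc k)) \<le> integral {n..n+j} \<psi>"
  proof (induction j)
    case (Suc j)
    have "\<psi> (Suc (n + j)) = integral {real (n+j)..real (Suc (n+j))} (\<lambda>_. \<psi> (Suc (n + j)))" by simp
    also have "\<dots> \<le> integral {real (n+j)..real (Suc (n+j))} \<psi>"
      using n by (intro integral_le psi_integrable antimono) auto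
    finally have "(\<Sum>k=n..<n+Suc j. \<psi> (Suc k)) \<le> integral {n..n+j} \<psi> + integral {real (n+j)..real (Suc (n+j))} \<psi>"
      using Suc by simp
    also have "\<dots> = integral {n..real (Suc (n+j))} \<psi>"
      using n by (intro Henstock_Kurzweil_Integration.integral_combine psi_integrable) auto
    finally show ?case by simp
  qed simp
  also have "\<dots> \<le> 4 * m * \<psi> n"
    using integral_psi_le[of "n + j"] by simp
  finally show ?thesis .
qed

text \<open>Convexity is applied at \<open>n\<close>, \<open>n * (1 + r)\<close> and
  \<open>(n + 1) * (1 + r)\<close>. The middle value is exactly \<open>\<psi> n / 2\<close> and the
  right one at most \<open>\<psi> (n + 1) / 2\<close>, so the chord inequality limits how far
  \<open>\<psi>\<close> can drop in one step from \<open>n\<close>.\<close>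

lemma step_le: "\<psi> n - \<psi> (n + 1) \<le> 3 / 2 * \<psi> n / m"
proof -
  let ?e = "n * (1 + r)" and ?e' = "(n + 1) * (1 + r)"
  have n1: "real n + 1 \<ge> 1" "real n \<ge> 1" using n by auto
  have cvx: "convex_on {1..} \<psi>" using M by (simp add: class_M_def)
  have e: "?e = n + m" using r n_pos by (auto simp: field_simps)
  then have e': "?e' = n + m + (1 + r)" by (simp add: algebra_simps)
  have h: "\<psi> ?e = \<psi> n / 2" using class_M_eta(1)[OF M n1(2)] eta_n by simp
  have h': "\<psi> ?e' \<le> \<psi> (n + 1) / 2" using psi_half[of "n + 1"] by (simp add: add.commute)
  have "(?e' - n) * \<psi> ?e \<le> (?e' - ?e) * \<psi> n + (?e - n) * \<psi> ?e'"
    unfolding e e' using r_pos m(2) n1 by (intro convex_three_points[OF cvx]) auto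
  also have "\<dots> \<le> (?e' - ?e) * \<psi> n + (?e - n) * (\<psi> (n + 1) / 2)"
    unfolding e e' using h'[unfolded e'] m(2) by (intro add_left_mono mult_left_mono) auto
  also have "(?e' - n) * \<psi> ?e = (m + (1 + r)) * (\<psi> n / 2)"
    unfolding h e' by simp
  also have "(?e' - ?e) * \<psi> n + (?e - n) * (\<psi> (n + 1) / 2) = (1 + r) * \<psi> n + m * (\<psi> (n + 1) / 2)"
    unfolding e e' by simp
  finally have "(m + (1 + r)) * (\<psi> n / 2) \<le> (1 + r) * \<psi> n + m * (\<psi> (n + 1) / 2)"
    .
  then have "m * (\<psi> n - \<psi> (n + 1)) \<le> (1 + r) * \<psi> n"
    by (simp add: algebra_simps)
  also have "\<dots> \<le> 3 / 2 * \<psi> n"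
    using r pos[OF n1(2)] by (intro mult_right_mono) auto
  finally show ?thesis using m(2) by (simp add: field_simps)
qed

lemma psi_convex_nat:
  assumes "1 \<le> k" shows "2 * \<psi> (Suc k) \<le> \<psi> k + \<psi> (Suc (Suc k))"
proof -
  have cvx: "convex_on {1..} \<psi>" using M by (simp add: class_M_def)
  show ?thesis
    using convex_three_points[OF cvx, of k "Suc (Suc k)" "Suc k"] assms by simp
qed

end

subsection \<open>A kernel with small norms\<close>

definition cos_series :: "(nat \<Rightarrow> real) \<Rightarrow> real \<Rightarrow> real \<Rightarrow> real" where
  "cos_series l \<theta> u = (\<Sum>k. l (Suc k) * cos (real (Suc k) * u - \<theta>))"

lemma cos_period_nat: "cos (real k * (u + 2 * pi) - \<theta>) = cos (real k * u - \<theta>)"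
proof -
  have "cos (real k * (u + 2 * pi) - \<theta>) = cos ((real k * u - \<theta>) + 2 * real k * pi)"
    by (simp add: algebra_simps)
  also have "\<dots> = cos (real k * u - \<theta>)"
    by (simp only: cos_add cos_2npi sin_2npi mult_1_right mult_zero_right diff_zero)
  finally show ?thesis .
qed

lemma periodic_cos_series: "periodic_2pi (cos_series l \<theta>)"
  unfolding periodic_2pi_def cos_series_def by (simp only: cos_period_nat) simp

lemma
  assumes l: "summable l" "\<And>k. 0 \<le> l (Suc k)"
  shows summable_cos_series: "summable (\<lambda>k. l (Suc k) * cos (real (Suc k) * u - \<theta>))"
    and cos_series_bound: "\<bar>cos_series l \<theta> u\<bar> \<le> (\<Sum>k. l (Suc k))"
    and continuous_cos_series: "continuous_on UNIV (cos_series l \<theta>)"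
proof -
  have le: "norm (l (Suc k) * cos (real (Suc k) * u - \<theta>)) \<le> l (Suc k)" for k u
    using l(2)[of k] by (simp add: abs_mult mult_left_le)
  have s: "summable (\<lambda>k. l (Suc k))" using l(1) by (subst summable_Suc_iff)
  show *: "summable (\<lambda>k. l (Suc k) * cos (real (Suc k) * u - \<theta>))" for u
    by (rule summable_comparison_test'[OF s]) (rule le)
  have "norm (cos_series l \<theta> u) \<le> (\<Sum>k. l (Suc k))"
    unfolding cos_series_def by (rule norm_suminf_le[OF le s]) 
  then show "\<bar>cos_series l \<theta> u\<bar> \<le> (\<Sum>k. l (Suc k))" by simp
  have "uniform_limit UNIV (\<lambda>N u. \<Sum>k<N. l (Suc k) * cos (real (Suc k) * u - \<theta>)) (cos_series l \<theta>) sequentially"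
    unfolding cos_series_def by (rule Weierstrass_m_test[OF le s])
  then show "continuous_on UNIV (cos_series l \<theta>)"
    by (rule uniform_limit_theorem[rotated]) (auto intro!: always_eventually continuous_intros)
qed

text \<open>Multiplying a cosine series by \<open>2 - 2 cos u\<close> turns its coefficients into their negated
  second differences; these sum to zero, so a single positive one bounds all the others.\<close>

lemma cos_series_second_difference:
  fixes l :: "nat \<Rightarrow> real"
  assumes l: "summable l" "\<And>k. 0 \<le> l k" and l01: "l 0 = 0" "l 1 = 0"
    and cvx: "\<And>k. k \<noteq> j \<Longrightarrow> 2 * l (Suc k) \<le> l k + l (Suc (Suc k))"
    and peak: "l j + l (Suc (Suc j)) \<le> 2 * l (Suc j)"
  shows "(2 - 2 * cos u) * \<bar>cos_series l \<theta> u\<bar> \<le> 2 * (2 * l (Suc j) - l j - l (Suc (Suc j)))"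
proof -
  define g where "g k = cos (real k * u - \<theta>)" for k
  define D where "D k = 2 * l (Suc k) - l k - l (Suc (Suc k))" for k
  have sg: "summable (\<lambda>k. l (Suc k) * g (h k))" for h
  proof (rule summable_comparison_test')
    show "summable (\<lambda>k. l (Suc k))" using l(1) by (subst summable_Suc_iff)
    show "norm (l (Suc k) * g (h k)) \<le> l (Suc k)" for k
      using l(2)[of "Suc k"] by (simp add: abs_mult mult_left_le g_def)
  qed
  define S where "S = cos_series l \<theta> u"
  have S: "(\<lambda>k. l (Suc k) * g (Suc k)) sums S"
    using summable_sums[OF sg[of Suc]] unfolding S_def cos_series_def g_def .
  obtain s1 where s1: "(\<lambda>k. l (Suc k) * g (Suc (Suc k))) sums s1"
    using sg[of "\<lambda>k. Suc (Suc k)"] by (auto simp: summable_def)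
  obtain s2 where s2: "(\<lambda>k. l (Suc k) * g k) sums s2"
    using sg[of "\<lambda>k. k"] by (auto simp: summable_def)
  \<comment> \<open>The shifts of index cost nothing, because the boundary terms carry the factors
    \<open>l 0 = 0\<close> and \<open>l 1 = 0\<close>.\<close>
  have s1': "(\<lambda>k. l k * g (Suc k)) sums s1"
    using s1 l01 by (subst (asm) sums_Suc_iff) simp
  have s2': "(\<lambda>k. l (Suc (Suc k)) * g (Suc k)) sums s2"
    using s2 l01 by (subst sums_Suc_iff) simp
  have trig: "(2 - 2 * cos u) * g (Suc k) = 2 * g (Suc k) - g (Suc (Suc k)) - g k" for k
  proof -
    have "g (Suc (Suc k)) = cos ((real (Suc k) * u - \<theta>) + u)" "g k = cos ((real (Suc k) * u - \<theta>) - u)"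
      by (simp_all add: g_def algebra_simps)
    then have "g (Suc (Suc k)) + g k = 2 * cos u * g (Suc k)"
      by (simp only: cos_add cos_diff g_def) (simp add: algebra_simps)
    then show ?thesis by (simp add: left_diff_distrib)
  qed
  have "(\<lambda>k. 2 * (l (Suc k) * g (Suc k)) - l (Suc k) * g (Suc (Suc k)) - l (Suc k) * g k) sums (2 * S - s1 - s2)"
    by (intro sums_diff sums_mult S s1 s2)
  moreover have "(\<lambda>k. (2 - 2 * cos u) * (l (Suc k) * g (Suc k))) sums ((2 - 2 * cos u) * S)"
    by (intro sums_mult S)
  moreover have "(2 - 2 * cos u) * (l (Suc k) * g (Suc k)) =
      2 * (l (Suc k) * g (Suc k)) - l (Suc k) * g (Suc (Suc k)) - l (Suc k) * g k" for k
  proof -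
    have "(2 - 2 * cos u) * (l (Suc k) * g (Suc k)) = l (Suc k) * ((2 - 2 * cos u) * g (Suc k))" by simp
    then show ?thesis unfolding trig by (simp add: algebra_simps)
  qed
  ultimately have "(2 - 2 * cos u) * S = 2 * S - s1 - s2"
    using sums_unique2 by simp
  moreover have "(\<lambda>k. 2 * (l (Suc k) * g (Suc k)) - l k * g (Suc k) - l (Suc (Suc k)) * g (Suc k)) sums (2 * S - s1 - s2)"
    by (intro sums_diff sums_mult S s1' s2')
  ultimately have D: "(\<lambda>k. D k * g (Suc k)) sums ((2 - 2 * cos u) * S)"
    by (simp add: D_def algebra_simps)
  obtain A where A: "l sums A" using l by (auto simp: summable_def)
  have A1: "(\<lambda>k. l (Suc k)) sums A" using A l01 by (subst sums_Suc_iff) simp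
  have A2: "(\<lambda>k. l (Suc (Suc k))) sums A" using A1 l01 by (subst sums_Suc_iff[of "\<lambda>k. l (Suc k)"]) simp
  have "D sums (2 * A - A - A)"
    unfolding D_def by (intro sums_diff sums_mult A A1 A2)
  then have "D sums 0" by simp
  \<comment> \<open>\<open>D j\<close> is nonnegative and every other \<open>D k\<close> is
    nonpositive, so this sequence is \<open>\<bar>D k\<bar>\<close>, and its sum is
    \<open>2 * D j\<close>.\<close>
  then have "(\<lambda>k. (if k = j then 2 * D j else 0) - D k) sums (2 * D j - 0)"
    by (intro sums_diff sums_single[of j "\<lambda>_. 2 * D j"])
  moreover have "(if k = j then 2 * D j else 0) - D k = \<bar>D k\<bar>" for k
    using cvx[of k] peak by (auto simp: D_def)
  ultimately have absD: "(\<lambda>k. \<bar>D k\<bar>) sums (2 * D j)" by simp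
  have "norm (\<Sum>k. D k * g (Suc k)) \<le> (\<Sum>k. \<bar>D k\<bar>)"
    using sums_summable[OF absD] by (intro norm_suminf_le) (auto simp: abs_mult mult_left_le g_def)
  then have "\<bar>(2 - 2 * cos u) * S\<bar> \<le> 2 * D j"
    using sums_unique[OF D] sums_unique[OF absD] by simp
  then show ?thesis
    unfolding abs_mult S_def D_def by simp
qed

text \<open>The sine is concave on \<open>{0..pi}\<close>, so on \<open>{0..pi / 2}\<close> it lies
  above the chord joining its end values.\<close>

lemma Jordan_sin_ge:
  assumes "0 \<le> x" "x \<le> pi / 2" shows "2 * x / pi \<le> sin x"
proof -
  have cvx: "convex_on {0..pi} (\<lambda>x. - sin x)"
    by (rule f''_ge0_imp_convex[where f' = "\<lambda>x. - cos x" and f'' = sin])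
       (auto intro!: derivative_eq_intros sin_ge_zero)
  consider "x = 0 \<or> x = pi / 2" | "0 < x" "x < pi / 2" using assms by linarith
  then show ?thesis
  proof cases
    case 2
    have "(pi / 2 - 0) * - sin x \<le> (pi / 2 - x) * - sin 0 + (x - 0) * - sin (pi / 2)"
      using 2 by (intro convex_three_points[OF cvx]) auto
    then show ?thesis by (simp add: field_simps)
  next
    case 1
    then show ?thesis
    proof
      assume "x = pi / 2" then show ?thesis by (simp only: sin_pi_half) simp
    qed simp
  qed
qed

text \<open>Jordan's inequality applied to \<open>2 - 2 * cos u = 4 * (sin (u / 2))\<^sup>2\<close>.
  It turns the second-difference bound into decay of order \<open>1 / u\<^sup>2\<close> on one
  period.\<close>

lemma two_minus_two_cos_ge:
  assumes "\<bar>u\<bar> \<le> pi" shows "(2 * u / pi)\<^sup>2 \<le> 2 - 2 * cos u"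
proof -
  have "2 * (\<bar>u\<bar> / 2) / pi \<le> sin (\<bar>u\<bar> / 2)"
    using assms by (intro Jordan_sin_ge) auto
  then have "(2 * (\<bar>u\<bar> / 2) / pi)\<^sup>2 \<le> (sin (\<bar>u\<bar> / 2))\<^sup>2"
    by (intro power_mono) auto
  then have "4 * (u / pi)\<^sup>2 \<le> 4 * (sin (\<bar>u\<bar> / 2))\<^sup>2"
    by (simp add: power_divide)
  also have "4 * (sin (\<bar>u\<bar> / 2))\<^sup>2 = 2 - 2 * cos \<bar>u\<bar>"
    using cos_double_sin[of "\<bar>u\<bar> / 2"] by simp
  finally show ?thesis by (simp add: power_divide power_mult_distrib abs_if split: if_splits)
qed

section \<open>The ramped kernel: uniform bound, decay and integral norm\<close>

context psi_at
begin

definition ramp :: nat where "ramp = nat \<lfloor>m\<rfloor>"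

text \<open>The maximum of 0 and an affine function is convex, and so is \<open>\<psi>\<close> from
  \<open>n\<close> on; convexity can therefore fail only at the peak \<open>n\<close>, as
  \<open>cos_series_second_difference\<close> demands.\<close>

definition ramp_coeff :: "nat \<Rightarrow> real" where
  "ramp_coeff k = (if k \<ge> n then \<psi> k else max 0 (\<psi> n * (real k - (real n - real ramp)) / real ramp))"

definition Ker :: "real \<Rightarrow> real \<Rightarrow> real" where
  "Ker \<theta> = cos_series ramp_coeff \<theta>"

lemma m_less: "m < n / 2"
  using mult_strict_right_mono[OF r(2) n_pos] r(1) n_pos by simp

text \<open>These bounds exchange \<open>ramp\<close> for \<open>m\<close> up to a factor 2 and put
  the foot \<open>n - ramp\<close> of the slope at index 1 or later, so that coefficients 0 and 1
  vanish.\<close>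

lemma ramp: "2 \<le> ramp" "real ramp \<le> m" "m / 2 \<le> real ramp" "ramp < n"
proof -
  have "2 \<le> \<lfloor>m\<rfloor>" using m(2) by linarith
  then have e: "real ramp = of_int \<lfloor>m\<rfloor>" and 2: "2 \<le> ramp" unfolding ramp_def by (auto simp: nat_le_iff le_nat_iff)
  show "2 \<le> ramp" by (fact 2)
  show le: "real ramp \<le> m" unfolding e by linarith
  show "m / 2 \<le> real ramp" using 2 real_of_int_floor_gt_diff_one[of m] unfolding e[symmetric] by linarith
  show "ramp < n" using le m_less n by linarith
qed

text \<open>The two branches agree at \<open>k = n\<close>, which makes the slope formula available
  up to and including the peak.\<close>

lemma ramp_coeff_le_n: "k \<le> n \<Longrightarrow> ramp_coeff k = max 0 (\<psi> n * (real k - (real n - real ramp)) / real ramp)"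
  using ramp(1) psi_nonneg[of n] by (auto simp: ramp_coeff_def)

lemma ramp_coeff_nonneg: "0 \<le> ramp_coeff k"
  using psi_nonneg[of k] by (auto simp: ramp_coeff_def)

lemma sum_tail_le': "(\<Sum>i<j. \<psi> (Suc (i + n))) \<le> 4 * m * \<psi> n"
  using sum_tail_le[of j] sum.shift_bounds_nat_ivl[of "\<lambda>k. \<psi> (Suc k)" 0 n j]
  by (simp add: lessThan_atLeast0 add.commute)

lemma summable_shifted: "summable (\<lambda>i. \<psi> (Suc (i + n)))"
  by (rule summableI_nonneg_bounded[OF _ sum_tail_le']) (auto intro!: psi_nonneg)

lemma summable_psi: "summable (\<lambda>k. \<psi> (real k))"
  using summable_shifted summable_iff_shift[of "\<lambda>k. \<psi> (real k)" "Suc n"] by simp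

lemma summable_ramp_coeff: "summable ramp_coeff"
  using summable_shifted summable_iff_shift[of ramp_coeff "Suc n"] by (simp add: ramp_coeff_def)

text \<open>The 5 is 4 from the tail beyond \<open>n\<close> plus 1 from the slope, where at most
  \<open>ramp\<close> coefficients are nonzero and each is at most \<open>\<psi> n\<close>.\<close>

lemma sum_ramp_coeff_le: "(\<Sum>k. ramp_coeff (Suc k)) \<le> 5 * m * \<psi> n"
proof -
  have *: "(\<Sum>k. ramp_coeff (Suc k)) = (\<Sum>k. ramp_coeff (Suc (k + n))) + (\<Sum>k<n. ramp_coeff (Suc k))"
    using suminf_split_initial_segment[of "\<lambda>k. ramp_coeff (Suc k)" n] summable_ramp_coeff by (simp add: summable_Suc_iff)
  have "(\<Sum>k. ramp_coeff (Suc (k + n))) = (\<Sum>k. \<psi> (Suc (k + n)))"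
    by (simp add: ramp_coeff_def)
  also have "\<dots> \<le> 4 * m * \<psi> n"
    by (rule suminf_le_const[OF summable_shifted sum_tail_le'])
  finally have 1: "(\<Sum>k. ramp_coeff (Suc (k + n))) \<le> 4 * m * \<psi> n" .
  have "(\<Sum>k<n. ramp_coeff (Suc k)) \<le> (\<Sum>k<n. if n - ramp \<le> k then \<psi> n else 0)"
  proof (rule sum_mono)
    fix k assume "k \<in> {..<n}"
    then have k: "Suc k \<le> n" by simp
    have "\<psi> n * (real (Suc k) - (real n - real ramp)) / real ramp \<le> (if n - ramp \<le> k then \<psi> n else 0)"
    proof (cases "n - ramp \<le> k")
      case True
      have "\<psi> n * (real (Suc k) - (real n - real ramp)) \<le> \<psi> n * real ramp"
        using k psi_nonneg[of n] by (intro mult_left_mono) auto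
      then show ?thesis using True ramp(1) by (simp add: divide_le_eq)
    next
      case False
      then have "real (Suc k) \<le> real n - real ramp" using ramp(4) by linarith
      then show ?thesis
        using False psi_nonneg[of n] by (simp add: divide_nonpos_nonneg mult_nonneg_nonpos)
    qed
    then show "ramp_coeff (Suc k) \<le> (if n - ramp \<le> k then \<psi> n else 0)"
      using psi_nonneg[of n] by (simp add: ramp_coeff_le_n[OF k])
  qed
  also have "\<dots> = (\<Sum>k\<in>{n - ramp..<n}. \<psi> n)"
    by (rule sum.mono_neutral_cong_right) auto
  also have "\<dots> = ramp * \<psi> n" using ramp by simp
  also have "\<dots> \<le> m * \<psi> n" using ramp psi_nonneg[of n] by (intro mult_right_mono) auto
  finally show ?thesis using 1 * by (simp add: algebra_simps)
qed

text \<open>The negated second difference at the peak is \<open>\<psi> n / ramp\<close> (slope on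
  the left) plus \<open>\<psi> n - \<psi> (n + 1)\<close> (drop on the right). These are at most 2
  and 3/2 times \<open>\<psi> n / m\<close>, and doubling gives 7.\<close>

lemma Ker_second_difference: "(2 - 2 * cos u) * \<bar>Ker \<theta> u\<bar> \<le> 7 * \<psi> n / m"
proof -
  \<comment> \<open>The second difference with index \<open>j\<close> is centred at
    \<open>Suc j\<close>, so the peak \<open>n\<close> belongs to \<open>j = n - 1\<close>.\<close>
  obtain j where j: "n = Suc j" using n by (cases n) auto
  have ramp_coeff_n: "ramp_coeff (Suc j) = \<psi> n" "ramp_coeff (Suc (Suc j)) = \<psi> (n + 1)"
    by (simp_all add: ramp_coeff_def add.commute flip: j)
  have "\<psi> n * (real j - (real n - real ramp)) / real ramp = \<psi> n - \<psi> n / ramp"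
    using ramp(1) by (simp add: j field_simps)
  moreover have "\<psi> n / ramp \<le> \<psi> n"
    using ramp(1) psi_nonneg[of n] by (simp add: divide_le_eq mult_le_cancel_left1)
  ultimately have ramp_coeff_j: "ramp_coeff j = \<psi> n - \<psi> n / ramp"
    using ramp_coeff_le_n[of j] j by simp
  have "\<psi> n / ramp \<le> 2 * \<psi> n / m"
    using ramp(1,3) m(2) psi_nonneg[of n] mult_left_mono[OF ramp(3), of "\<psi> n"] by (simp add: field_simps)
  then have le: "2 * (2 * ramp_coeff (Suc j) - ramp_coeff j - ramp_coeff (Suc (Suc j))) \<le> 7 * \<psi> n / m"
    unfolding ramp_coeff_n ramp_coeff_j using step_le by simp
  have "(2 - 2 * cos u) * \<bar>cos_series ramp_coeff \<theta> u\<bar> \<le> 2 * (2 * ramp_coeff (Suc j) - ramp_coeff j - ramp_coeff (Suc (Suc j)))"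
  proof (rule cos_series_second_difference[OF summable_ramp_coeff ramp_coeff_nonneg])
    have "real 1 \<le> real n - real ramp" using ramp(4) by linarith
    then have "k \<le> 1 \<Longrightarrow> \<psi> n * (real k - (real n - real ramp)) / real ramp \<le> 0" for k
      using psi_nonneg[of n] by (intro divide_nonpos_nonneg mult_nonneg_nonpos) auto
    from this[of 0] this[of 1] show "ramp_coeff 0 = 0" "ramp_coeff 1 = 0" using n by (auto simp: ramp_coeff_le_n)
    show "ramp_coeff j + ramp_coeff (Suc (Suc j)) \<le> 2 * ramp_coeff (Suc j)"
    proof -
      have "\<psi> (n + 1) \<le> \<psi> n" using n by (intro antimono) auto
      moreover have "0 \<le> \<psi> n / ramp" using psi_nonneg[of n] by simp
      ultimately show ?thesis unfolding ramp_coeff_n ramp_coeff_j by linarith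
    qed
    fix k assume "k \<noteq> j"
    then consider "k \<ge> n" | "Suc (Suc k) \<le> n" using j by linarith
    then show "2 * ramp_coeff (Suc k) \<le> ramp_coeff k + ramp_coeff (Suc (Suc k))"
    proof cases
      case 1
      then show ?thesis using psi_convex_nat[of k] n by (simp add: ramp_coeff_def)
    next
      case 2
      define f where "f k = \<psi> n * (real k - (real n - real ramp)) / real ramp" for k
      have "2 * f (Suc k) = f k + f (Suc (Suc k))"
        using ramp(1) by (simp add: f_def field_simps)
      moreover have "ramp_coeff i = max 0 (f i)" if "i \<le> n" for i
        using ramp_coeff_le_n[OF that] by (simp add: f_def)
      ultimately show ?thesis using 2 by (simp del: of_nat_Suc)
    qed
  qed
  then show ?thesis using le unfolding Ker_def by linarith
qed

lemma Ker_continuous: "continuous_on UNIV (Ker \<theta>)"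
  unfolding Ker_def by (rule continuous_cos_series[OF summable_ramp_coeff ramp_coeff_nonneg])

lemma Ker_periodic: "periodic_2pi (Ker \<theta>)"
  unfolding Ker_def by (rule periodic_cos_series)

lemma Ker_bound: "\<bar>Ker \<theta> u\<bar> \<le> 5 * m * \<psi> n"
  using cos_series_bound[OF summable_ramp_coeff ramp_coeff_nonneg, of \<theta> u] sum_ramp_coeff_le unfolding Ker_def by linarith

text \<open>The sum of two bounds: 5 from \<open>Ker_bound\<close> and 7 from
  \<open>Ker_second_difference\<close> multiplied by \<open>m\<^sup>2\<close>. The combined form has
  an explicit primitive.\<close>

lemma Ker_decay:
  assumes "\<bar>u\<bar> \<le> pi" shows "\<bar>Ker \<theta> u\<bar> \<le> 12 * m * \<psi> n / (1 + (2 * m / pi * u)\<^sup>2)"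
proof -
  have "(2 * m / pi * u)\<^sup>2 * \<bar>Ker \<theta> u\<bar> = m\<^sup>2 * ((2 * u / pi)\<^sup>2 * \<bar>Ker \<theta> u\<bar>)"
    by (simp add: power_mult_distrib power_divide)
  also have "\<dots> \<le> m\<^sup>2 * ((2 - 2 * cos u) * \<bar>Ker \<theta> u\<bar>)"
    using two_minus_two_cos_ge[OF assms] by (intro mult_left_mono mult_right_mono) auto
  also have "\<dots> \<le> m\<^sup>2 * (7 * \<psi> n / m)"
    by (intro mult_left_mono Ker_second_difference) auto
  also have "\<dots> = 7 * m * \<psi> n" using m(2) by (simp add: power2_eq_square)
  finally have "(1 + (2 * m / pi * u)\<^sup>2) * \<bar>Ker \<theta> u\<bar> \<le> 12 * m * \<psi> n"
    using Ker_bound[of \<theta> u] by (simp add: distrib_right)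
  moreover have "0 < 1 + (2 * m / pi * u)\<^sup>2" by (rule add_pos_nonneg) auto
  ultimately show ?thesis by (simp add: pos_le_divide_eq mult.commute)
qed

text \<open>The majorant of \<open>Ker_decay\<close> integrates to an arctangent, whose total
  variation is less than \<open>pi\<close>; this removes \<open>m\<close> from the bound.\<close>

lemma integral_Ker_le: "integral {-pi..pi} (\<lambda>u. \<bar>Ker \<theta> u\<bar>) \<le> 6 * pi\<^sup>2 * \<psi> n"
proof -
  define q where "q = 2 * m / pi"
  have q: "q > 0" using m(2) by (simp add: q_def)
  define F where "F u = 6 * pi * \<psi> n * arctan (q * u)" for u
  have "((\<lambda>u. 12 * m * \<psi> n / (1 + (q * u)\<^sup>2)) has_integral F pi - F (- pi)) {-pi..pi}"
  proof (rule fundamental_theorem_of_calculus)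
    fix u assume "u \<in> {-pi..pi}"
    have "(F has_real_derivative 6 * pi * \<psi> n * (q / (1 + (q * u)\<^sup>2))) (at u within {-pi..pi})"
      unfolding F_def by (auto intro!: derivative_eq_intros simp: field_simps)
    moreover have "6 * pi * \<psi> n * (q / (1 + (q * u)\<^sup>2)) = 12 * m * \<psi> n / (1 + (q * u)\<^sup>2)"
      by (simp add: q_def)
    ultimately show "(F has_vector_derivative 12 * m * \<psi> n / (1 + (q * u)\<^sup>2)) (at u within {-pi..pi})"
      by (simp only: has_real_derivative_iff_has_vector_derivative)
  qed auto
  then have "integral {-pi..pi} (\<lambda>u. \<bar>Ker \<theta> u\<bar>) \<le> F pi - F (- pi)"
    using Ker_decay
    by (intro has_integral_le[OF integrable_integral] integrable_continuous_real continuous_intros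
          continuous_on_subset[OF Ker_continuous]) (auto simp: q_def abs_le_iff)
  also have "\<dots> = 6 * pi * \<psi> n * (2 * arctan (q * pi))"
    by (simp add: F_def arctan_minus)
  also have "\<dots> \<le> 6 * pi * \<psi> n * pi"
    using arctan_ubound[of "q * pi"] psi_nonneg[of n] by (intro mult_left_mono) auto
  finally show ?thesis by (simp add: power2_eq_square mult_ac)
qed

lemma Psi_eq: "Psi \<psi> \<beta> = cos_series (\<lambda>k. \<psi> (real k)) (\<beta> * pi / 2)"
  by (simp add: Psi_def cos_series_def fun_eq_iff)

end

subsection \<open>Convolution with periodic functions\<close>

lemma set_borel_integral_continuous:
  fixes f :: "real \<Rightarrow> real"
  assumes "continuous_on {a..b} f"
  shows "(LINT x:{a..b}|lborel. f x) = integral {a..b} f"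
  using borel_integrable_atLeastAtMost'[OF assms] by (rule set_borel_integral_eq_integral)

lemma periodic_2pi_minus: "periodic_2pi h \<Longrightarrow> h (x - 2 * pi) = h x"
  unfolding periodic_2pi_def by (metis diff_add_cancel)

lemma integral_periodic:
  fixes h :: "real \<Rightarrow> real"
  assumes c: "continuous_on UNIV h" and p: "periodic_2pi h"
  shows "integral {a..a + 2 * pi} h = integral {b..b + 2 * pi} h"
proof -
  have int: "h integrable_on {s..t}" for s t
    using c by (intro integrable_continuous_real continuous_on_subset[OF c]) auto
  have *: "integral {a..a + 2 * pi} h = integral {b..b + 2 * pi} h" if "a \<le> b" "b \<le> a + 2 * pi" for a b
  proof -
    have "(h has_integral integral {a..b} h) (cbox a b)"
      using int by (auto simp: cbox_interval)
    then have "((\<lambda>x. h (x + (- (2 * pi)))) has_integral integral {a..b} h) (cbox (a - (- (2 * pi))) (b - (- (2 * pi))))"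
      by (rule has_integral_shift_cbox)
    then have "integral {a + 2 * pi..b + 2 * pi} h = integral {a..b} h"
      using periodic_2pi_minus[OF p] by (auto simp: cbox_interval intro!: integral_unique)
    moreover have "integral {a..b} h + integral {b..a + 2 * pi} h = integral {a..a + 2 * pi} h"
      using that int by (intro Henstock_Kurzweil_Integration.integral_combine) auto
    moreover have "integral {b..a + 2 * pi} h + integral {a + 2 * pi..b + 2 * pi} h = integral {b..b + 2 * pi} h"
      using that int by (intro Henstock_Kurzweil_Integration.integral_combine) auto
    ultimately show ?thesis by simp
  qed
  have "integral {a..a + 2 * pi} h = integral {a + 2 * pi * real k..a + 2 * pi * real k + 2 * pi} h" for a k
  proof (induction k)
    case (Suc k)
    then show ?case using *[of "a + 2 * pi * real k" "a + 2 * pi * real (Suc k)"] by (simp add: algebra_simps)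
  qed simp
  note shift = this
  have "integral {a..a + 2 * pi} h = integral {b..b + 2 * pi} h" if "a \<le> b" for a b
  proof -
    \<comment> \<open>\<open>k\<close> whole periods between \<open>a\<close> and \<open>b\<close>
      are removed; the remaining offset is less than one period, which \<open>*\<close>
      covers.\<close>
    define k where "k = nat \<lfloor>(b - a) / (2 * pi)\<rfloor>"
    have "real k = of_int \<lfloor>(b - a) / (2 * pi)\<rfloor>" using that by (simp add: k_def)
    then have "real k \<le> (b - a) / (2 * pi)" "(b - a) / (2 * pi) < real k + 1" by linarith+
    then have "a + 2 * pi * real k \<le> b" "b \<le> a + 2 * pi * real k + 2 * pi"
      by (auto simp: field_simps)
    from *[OF this] shift[of a k] show ?thesis by simp
  qed
  then show ?thesis by (metis linorder_linear)
qed

lemma integral_reflect_shift: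
  fixes h :: "real \<Rightarrow> real"
  assumes c: "continuous_on UNIV h" and p: "periodic_2pi h"
  shows "integral {a..a + 2 * pi} (\<lambda>t. h (x - t)) = integral {b..b + 2 * pi} h"
proof -
  have "(h has_integral integral {x - a - 2 * pi..x - a} h) (cbox (x - a - 2 * pi) (x - a))"
    unfolding cbox_interval by (intro integrable_integral integrable_continuous_real continuous_on_subset[OF c]) auto
  from has_integral_affinity[OF this, of "-1" x]
  have "((\<lambda>t. h (x - t)) has_integral integral {x - a - 2 * pi..x - a} h) {a..a + 2 * pi}"
    by (simp add: cbox_interval image_diff_atLeastAtMost uminus_add_conv_diff add.commute)
  moreover have "integral {x - a - 2 * pi..x - a} h = integral {b..b + 2 * pi} h"
    using integral_periodic[OF c p, of "x - a - 2 * pi" b] by simp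
  ultimately show ?thesis by (simp add: integral_unique)
qed

text \<open>\<open>B0\<close> normalises over \<open>{0..2 * pi}\<close> while
  \<open>L_class\<close> convolves over \<open>{-pi..pi}\<close>. Moving \<open>{pi..2 * pi}\<close>
  back by one period reconciles them; the pieces share a single point, hence disjointness only
  almost everywhere.\<close>

lemma
  fixes h :: "real \<Rightarrow> real"
  assumes p: "periodic_2pi h" and i: "set_integrable lborel {0..2 * pi} h"
  shows set_integrable_periodic_shift: "set_integrable lborel {-pi..pi} h"
    and set_integral_periodic_shift: "(LINT t:{-pi..pi}|lborel. h t) = (LINT t:{0..2 * pi}|lborel. h t)"
proof -
  have i1: "set_integrable lborel {0..pi} h" and i2: "set_integrable lborel {pi..2*pi} h"
    by (rule set_integrable_subset[OF i]; simp)+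
  have ind: "indicator {pi..2*pi} (2 * pi + 1 * t) *\<^sub>R h (2 * pi + 1 * t) = indicator {-pi..0} t *\<^sub>R h t" for t
    using p by (auto simp: periodic_2pi_def indicator_def add.commute)
  have i3: "set_integrable lborel {-pi..0} h"
    using lborel_integrable_real_affine[OF i2[unfolded set_integrable_def], of 1 "2 * pi"]
    unfolding ind set_integrable_def by simp
  have e3: "(LINT t:{pi..2*pi}|lborel. h t) = (LINT t:{-pi..0}|lborel. h t)"
    unfolding set_lebesgue_integral_def
    using lborel_integral_real_affine[of 1 "\<lambda>t. indicator {pi..2*pi} t *\<^sub>R h t" "2 * pi"]
    unfolding ind by simp
  have AE0: "AE x in lborel. x \<noteq> (c::real)" for c by (rule AE_lborel_singleton)
  have u1: "{-pi..pi} = {-pi..0} \<union> {0..pi}" and u2: "{0..2*pi} = {0..pi} \<union> {pi..2*pi}" by auto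
  show "set_integrable lborel {-pi..pi} h"
    unfolding u1 by (intro set_integrable_Un i1 i3) auto
  have "(LINT t:{-pi..pi}|lborel. h t) = (LINT t:{-pi..0}|lborel. h t) + (LINT t:{0..pi}|lborel. h t)"
    unfolding u1 by (intro set_integral_Un_AE i1 i3) (auto intro!: eventually_mono[OF AE0[of 0]])
  moreover have "(LINT t:{0..2*pi}|lborel. h t) = (LINT t:{0..pi}|lborel. h t) + (LINT t:{pi..2*pi}|lborel. h t)"
    unfolding u2 by (intro set_integral_Un_AE i1 i2) (auto intro!: eventually_mono[OF AE0[of pi]])
  ultimately show "(LINT t:{-pi..pi}|lborel. h t) = (LINT t:{0..2 * pi}|lborel. h t)"
    using e3 by simp
qed

lemma set_integrable_bounded_continuous_mult:
  fixes g h :: "real \<Rightarrow> real"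
  assumes g: "continuous_on UNIV g" "\<And>t. \<bar>g t\<bar> \<le> A" and h: "set_integrable lborel S h" 
  shows "set_integrable lborel S (\<lambda>t. g t * h t)"
proof -
  have [measurable]: "g \<in> borel_measurable borel" using g(1) by (rule borel_measurable_continuous_onI)
  have [measurable]: "(\<lambda>t. indicator S t *\<^sub>R h t) \<in> borel_measurable lborel"
    using h unfolding set_integrable_def by auto
  have "integrable lborel (\<lambda>t. A * (indicator S t *\<^sub>R h t))"
    using h unfolding set_integrable_def by (rule integrable_mult_right)
  then have "integrable lborel (\<lambda>t. g t * (indicator S t *\<^sub>R h t))"
  proof (rule Bochner_Integration.integrable_bound)
    have "\<bar>g t\<bar> * \<bar>indicator S t * h t\<bar> \<le> \<bar>A\<bar> * \<bar>indicator S t * h t\<bar>" for t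
      using g(2)[of t] by (intro mult_right_mono) auto
    then show "AE t in lborel. norm (g t * (indicator S t *\<^sub>R h t)) \<le> norm (A * (indicator S t *\<^sub>R h t))"
      by (auto simp: abs_mult)
  qed measurable
  then show ?thesis unfolding set_integrable_def by (simp add: mult_ac)
qed

lemma inv_p_ereal: "inv_p (ereal q) = 1 / q"
  by (simp add: inv_p_def)

text \<open>Young's inequality in the form \<open>y \<le> m powr (1/q) * (1 - 1/q + y powr q / (q * m))\<close> replaces
  Hoelder's inequality and treats all finite exponents uniformly.\<close>

lemma convolution_bound:
  fixes K \<phi> :: "real \<Rightarrow> real"
  assumes K: "continuous_on UNIV K" "periodic_2pi K" "\<And>t. \<bar>K t\<bar> \<le> G * m"
    and L1: "integral {-pi..pi} (\<lambda>t. \<bar>K t\<bar>) \<le> G" and m: "0 < m" and G: "0 \<le> G"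
    and p: "1 \<le> p" and \<phi>: "\<phi> \<in> B0 p"
  shows "\<bar>LINT t:{-pi..pi}|lborel. K (x - t) * \<phi> t\<bar> \<le> G * m powr inv_p p"
proof -
  let ?I = "{0..2 * pi}"
  define g where "g t = K (x - t)" for t
  have "continuous_on UNIV g"
    unfolding g_def by (intro continuous_on_compose2[OF K(1)] continuous_intros) auto
  then have g: "continuous_on UNIV g" "\<And>t. \<bar>g t\<bar> \<le> G * m" "periodic_2pi g"
    using K(3) periodic_2pi_minus[OF K(2), of "x - _"]
    by (auto simp: g_def periodic_2pi_def algebra_simps)
  have ga: "continuous_on S (\<lambda>t. \<bar>g t\<bar>)" for S
    by (intro continuous_intros continuous_on_subset[OF g(1)]) auto
  have \<phi>p: "periodic_2pi \<phi>" and \<phi>i: "set_integrable lborel ?I \<phi>"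
    and \<phi>inf: "p = \<infinity> \<Longrightarrow> AE t in lborel. t \<in> ?I \<longrightarrow> \<bar>\<phi> t\<bar> \<le> 1"
    using \<phi> by (auto simp: B0_def)
  have gi: "set_integrable lborel ?I (\<lambda>t. g t * \<phi> t)"
    by (rule set_integrable_bounded_continuous_mult[OF g(1,2) \<phi>i])
  have gai: "set_integrable lborel ?I (\<lambda>t. \<bar>g t\<bar>)"
    by (rule borel_integrable_atLeastAtMost'[OF ga])
  have "integral ?I (\<lambda>t. \<bar>g t\<bar>) = integral {-pi..pi} (\<lambda>t. \<bar>K t\<bar>)"
    using integral_reflect_shift[of "\<lambda>t. \<bar>K t\<bar>" 0 x "-pi"] K(1,2)
    by (auto simp: g_def periodic_2pi_def intro!: continuous_intros)
  then have gL1: "(LINT t:?I|lborel. \<bar>g t\<bar>) \<le> G"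
    using L1 by (simp add: set_borel_integral_continuous[OF ga])
  have "(LINT t:{-pi..pi}|lborel. g t * \<phi> t) = (LINT t:?I|lborel. g t * \<phi> t)"
    using g(3) \<phi>p gi by (intro set_integral_periodic_shift) (auto simp: periodic_2pi_def)
  then have "\<bar>LINT t:{-pi..pi}|lborel. g t * \<phi> t\<bar> \<le> (LINT t:?I|lborel. \<bar>g t * \<phi> t\<bar>)"
    using set_integral_norm_bound[OF gi] by simp
  also have "\<dots> \<le> G * m powr inv_p p"
  proof (cases p)
    case PInf
    have "(LINT t:?I|lborel. \<bar>g t * \<phi> t\<bar>) \<le> (LINT t:?I|lborel. \<bar>g t\<bar>)"
    proof (rule set_integral_mono_AE)
      show "AE t in lborel. t \<in> ?I \<longrightarrow> \<bar>g t * \<phi> t\<bar> \<le> \<bar>g t\<bar>"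
        using \<phi>inf[OF PInf] by eventually_elim (auto simp: abs_mult mult_left_le)
    qed (use gi gai in \<open>auto intro: set_integrable_abs\<close>)
    then show ?thesis using gL1 m PInf by (simp add: inv_p_def)
  next
    case (real q)
    then have q: "1 \<le> q" using p by simp
    have \<phi>q: "set_integrable lborel ?I (\<lambda>t. \<bar>\<phi> t\<bar> powr q)"
      "(LINT t:?I|lborel. \<bar>\<phi> t\<bar> powr q) powr (1 / q) \<le> 1"
      using \<phi> real by (auto simp: B0_def)
    have \<phi>1: "(LINT t:?I|lborel. \<bar>\<phi> t\<bar> powr q) \<le> 1"
    proof (rule ccontr)
      assume "\<not> ?thesis"
      then have "1 < (LINT t:?I|lborel. \<bar>\<phi> t\<bar> powr q) powr (1 / q)"
        using q by (intro gr_one_powr) auto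
      with \<phi>q(2) show False by simp
    qed
    define s where "s = 1 / q"
    have s: "0 < s" "s \<le> 1" using q by (auto simp: s_def)
    have young: "y \<le> m powr s * ((1 - s) + s * (y powr q / m))" if "y \<ge> 0" for y
    proof (cases "y = 0")
      case False
      then have y: "y > 0" using that by simp
      \<comment> \<open>Weighted arithmetic-geometric mean of \<open>y powr q / m\<close> and 1,
        with weights \<open>s\<close> and \<open>1 - s\<close>.\<close>
      have "(y powr q / m) powr s * 1 powr (1 - s) \<le> s * (y powr q / m) + (1 - s) * 1"
        using s y m by (intro Youngs_inequality_0) auto
      moreover have "(y powr q / m) powr s = y / m powr s"
        using y m q by (simp add: powr_divide powr_powr s_def)
      ultimately show ?thesis using m by (simp add: field_simps)
    qed (use s in auto)
    have "(LINT t:?I|lborel. \<bar>g t * \<phi> t\<bar>) \<le>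
        (LINT t:?I|lborel. m powr s * ((1 - s) * \<bar>g t\<bar> + s * G * (\<bar>\<phi> t\<bar> powr q)))"
    proof (rule set_integral_mono)
      fix t
      \<comment> \<open>The uniform bound \<open>G * m\<close> on \<open>g\<close> is spent only
        beside \<open>\<phi>\<close>, where it cancels \<open>1 / m\<close>. In the other summand
        \<open>g\<close> is kept for its integral bound \<open>G\<close>, so both parts end with the
        same constant for every \<open>q\<close>.\<close>
      have "\<bar>g t\<bar> * (s * (\<bar>\<phi> t\<bar> powr q / m)) \<le> (G * m) * (s * (\<bar>\<phi> t\<bar> powr q / m))"
        using g(2) s m by (intro mult_right_mono) auto
      also have "\<dots> = s * G * (\<bar>\<phi> t\<bar> powr q)" using m by simp
      finally have *: "\<bar>g t\<bar> * (s * (\<bar>\<phi> t\<bar> powr q / m)) \<le> s * G * (\<bar>\<phi> t\<bar> powr q)" .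
      have "\<bar>g t * \<phi> t\<bar> \<le> \<bar>g t\<bar> * (m powr s * ((1 - s) + s * (\<bar>\<phi> t\<bar> powr q / m)))"
        unfolding abs_mult by (intro mult_left_mono young) auto
      also have "\<dots> = m powr s * ((1 - s) * \<bar>g t\<bar> + \<bar>g t\<bar> * (s * (\<bar>\<phi> t\<bar> powr q / m)))"
        by (simp add: algebra_simps)
      also have "\<dots> \<le> m powr s * ((1 - s) * \<bar>g t\<bar> + s * G * (\<bar>\<phi> t\<bar> powr q))"
        using * by (intro mult_left_mono add_left_mono) auto
      finally show "\<bar>g t * \<phi> t\<bar> \<le> m powr s * ((1 - s) * \<bar>g t\<bar> + s * G * (\<bar>\<phi> t\<bar> powr q))" .
    qed (use gi gai \<phi>q in \<open>auto intro!: set_integrable_abs set_integral_add\<close>)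
    also have "\<dots> = m powr s * ((1 - s) * (LINT t:?I|lborel. \<bar>g t\<bar>) + s * G * (LINT t:?I|lborel. \<bar>\<phi> t\<bar> powr q))"
      using gai \<phi>q by (simp add: set_integral_add)
    also have "\<dots> \<le> m powr s * ((1 - s) * G + s * G * 1)"
      using gL1 \<phi>1 s G by (intro mult_left_mono add_mono) auto
    also have "\<dots> = G * m powr inv_p p"
      using real by (simp add: inv_p_ereal s_def algebra_simps)
    finally show ?thesis .
  qed (use p in auto)
  finally show ?thesis by (simp add: g_def)
qed

subsection \<open>Upper bound\<close>

lemma set_integral_sum:
  fixes f :: "'i \<Rightarrow> 'a \<Rightarrow> real"
  assumes "\<And>i. i \<in> I \<Longrightarrow> set_integrable M A (f i)"
  shows "(LINT x:A|M. \<Sum>i\<in>I. f i x) = (\<Sum>i\<in>I. LINT x:A|M. f i x)"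
  using assms unfolding set_lebesgue_integral_def set_integrable_def
  by (simp only: scaleR_sum_right Bochner_Integration.integral_sum)

text \<open>The representation in \<open>L_class\<close> holds only almost everywhere. Continuity
  removes the exceptional set: \<open>h\<close> exceeds \<open>c\<close> on an open set, and a
  nonempty open set is not null.\<close>

lemma AE_continuous_le:
  fixes h :: "real \<Rightarrow> real"
  assumes c: "continuous_on UNIV h" and ae: "AE x in lborel. h x \<le> c"
  shows "h x \<le> c"
proof (rule ccontr)
  assume "\<not> h x \<le> c"
  then have ne: "{x. c < h x} \<noteq> {}" by (auto intro!: exI[of _ x])
  have op: "open {x. c < h x}" by (intro open_Collect_less c continuous_intros)
  have "{x. c < h x} \<in> null_sets lborel"
    using ae op by (subst AE_iff_null_sets) (auto simp: not_less)
  then have "negligible {x. c < h x}"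
    by (simp add: negligible_iff_null_sets null_sets_completionI)
  with open_not_negligible[OF op ne] show False by simp
qed

lemma trig_polys_continuous:
  assumes "T \<in> trig_polys n" shows "continuous_on S T"
proof -
  obtain a b where "T = (\<lambda>x. \<Sum>k<n. a k * cos (real k * x) + b k * sin (real k * x))"
    using assms by (auto simp: trig_polys_def fun_eq_iff)
  then show ?thesis by (auto intro!: continuous_intros)
qed

lemma const_trig_poly_add:
  assumes "T \<in> trig_polys n" "1 \<le> n" shows "(\<lambda>x. c + T x) \<in> trig_polys n"
proof -
  obtain a b where T: "T = (\<lambda>x. \<Sum>k<n. a k * cos (real k * x) + b k * sin (real k * x))"
    using assms by (auto simp: trig_polys_def fun_eq_iff)
  obtain j where j: "n = Suc j" using assms by (cases n) auto
  define a' where "a' = a(0 := a 0 + c)"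
  have "c + T x = (\<Sum>k<n. a' k * cos (real k * x) + b k * sin (real k * x))" for x
    unfolding T j by (simp only: sum.lessThan_Suc_shift) (simp add: a'_def)
  then show ?thesis unfolding trig_polys_def by blast
qed

text \<open>Reading the argument as \<open>real k * x - (real k * t + \<theta>)\<close> separates
  \<open>x\<close> from \<open>t\<close> by the addition formula; the integrals over
  \<open>t\<close> become the coefficients.\<close>

lemma convolution_trig_poly:
  assumes \<phi>: "set_integrable lborel S \<phi>"
  shows "(\<lambda>x. LINT t:S|lborel. (\<Sum>k<n. d k * cos (real k * (x - t) - \<theta>)) * \<phi> t) \<in> trig_polys n"
proof -
  define A where "A k = (LINT t:S|lborel. d k * cos (real k * t + \<theta>) * \<phi> t)" for k
  define B where "B k = (LINT t:S|lborel. d k * sin (real k * t + \<theta>) * \<phi> t)" for k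
  have iA: "set_integrable lborel S (\<lambda>t. d k * cos (real k * t + \<theta>) * \<phi> t)" for k
    by (rule set_integrable_bounded_continuous_mult[where A = "\<bar>d k\<bar>", OF _ _ \<phi>])
       (auto simp: abs_mult mult_left_le intro!: continuous_intros)
  have iB: "set_integrable lborel S (\<lambda>t. d k * sin (real k * t + \<theta>) * \<phi> t)" for k
    by (rule set_integrable_bounded_continuous_mult[where A = "\<bar>d k\<bar>", OF _ _ \<phi>])
       (auto simp: abs_mult mult_left_le intro!: continuous_intros)
  have "(LINT t:S|lborel. (\<Sum>k<n. d k * cos (real k * (x - t) - \<theta>)) * \<phi> t) =
      (\<Sum>k<n. A k * cos (real k * x) + B k * sin (real k * x))" for x
  proof -
    have "d k * cos (real k * (x - t) - \<theta>) * \<phi> t = cos (real k * x) * (d k * cos (real k * t + \<theta>) * \<phi> t) +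
        sin (real k * x) * (d k * sin (real k * t + \<theta>) * \<phi> t)" for k t
    proof -
      have "cos (real k * (x - t) - \<theta>) = cos (real k * x - (real k * t + \<theta>))" by (simp add: algebra_simps)
      then show ?thesis by (simp only: cos_diff) (simp add: algebra_simps)
    qed
    then have "(LINT t:S|lborel. (\<Sum>k<n. d k * cos (real k * (x - t) - \<theta>)) * \<phi> t) =
      (LINT t:S|lborel. \<Sum>k<n. cos (real k * x) * (d k * cos (real k * t + \<theta>) * \<phi> t) +
        sin (real k * x) * (d k * sin (real k * t + \<theta>) * \<phi> t))"
      by (simp only: sum_distrib_right)
    also have "\<dots> = (\<Sum>k<n. cos (real k * x) * A k + sin (real k * x) * B k)"
      unfolding A_def B_def using iA iB
      by (subst set_integral_sum) (auto simp: set_integral_add intro!: set_integral_add(1) sum.cong)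
    finally show ?thesis by (simp add: mult.commute)
  qed
  then show ?thesis by (auto simp: trig_polys_def)
qed

section \<open>Approximation of the class by removing low frequencies\<close>

context psi_at
begin

lemma psi_Suc_nonneg: "0 \<le> \<psi> (real (Suc k))"
  using pos[of "real (Suc k)"] by simp

text \<open>Both series have the same coefficients from \<open>n\<close> on, so their difference is
  a finite cosine sum of degree below \<open>n\<close>, which the approximating polynomial can
  absorb.\<close>

lemma Psi_minus_Ker:
  obtains d where "\<And>u. Psi \<psi> \<beta> u = Ker (\<beta> * pi / 2) u + (\<Sum>k<n. d k * cos (real k * u - \<beta> * pi / 2))"
proof
  fix u
  let ?\<theta> = "\<beta> * pi / 2"
  \<comment> \<open>Both series start at frequency 1, so the coefficient of frequency 0 has to be
    0.\<close>
  let ?d = "\<lambda>k. if k = 0 then 0 else \<psi> (real k) - ramp_coeff k"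
  obtain j where j: "n = Suc j" using n by (cases n) auto
  note s1 = summable_cos_series[OF summable_psi, of u ?\<theta>, OF psi_Suc_nonneg]
  note s2 = summable_cos_series[OF summable_ramp_coeff ramp_coeff_nonneg, of u ?\<theta>]
  have "Psi \<psi> \<beta> u - Ker ?\<theta> u = (\<Sum>k. \<psi> (real (Suc k)) * cos (real (Suc k) * u - ?\<theta>) - ramp_coeff (Suc k) * cos (real (Suc k) * u - ?\<theta>))"
    unfolding Psi_eq Ker_def cos_series_def by (rule suminf_diff[OF s1 s2])
  also have "\<dots> = (\<Sum>k<j. \<psi> (real (Suc k)) * cos (real (Suc k) * u - ?\<theta>) - ramp_coeff (Suc k) * cos (real (Suc k) * u - ?\<theta>))"
  proof (rule suminf_finite)
    fix k assume "k \<notin> {..<j}"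
    then have "n \<le> Suc k" using j by simp
    then show "\<psi> (real (Suc k)) * cos (real (Suc k) * u - ?\<theta>) - ramp_coeff (Suc k) * cos (real (Suc k) * u - ?\<theta>) = 0"
      by (simp add: ramp_coeff_def)
  qed simp
  also have "\<dots> = (\<Sum>k<n. ?d k * cos (real k * u - ?\<theta>))"
    unfolding j by (simp only: sum.lessThan_Suc_shift) (simp add: left_diff_distrib)
  finally show "Psi \<psi> \<beta> u = Ker ?\<theta> u + (\<Sum>k<n. ?d k * cos (real k * u - ?\<theta>))" by simp
qed

text \<open>\<open>T\<close> collects the constant and the convolution with the low-degree part of
  \<open>Psi\<close>; what remains is \<open>1 / pi\<close> times the convolution of
  \<open>\<phi>\<close> with \<open>Ker\<close>, to which \<open>convolution_bound\<close>
  applies.\<close>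

lemma C_class_approximation:
  assumes p: "1 \<le> p" and f: "f \<in> C_class \<psi> \<beta> p"
  obtains T where "T \<in> trig_polys n"
    "\<And>x. \<bar>f x - T x\<bar> \<le> 6 * (1 + pi\<^sup>2) / pi * \<psi> n * m powr inv_p p"
proof -
  let ?\<theta> = "\<beta> * pi / 2" and ?S = "{-pi..pi}"
  \<comment> \<open>One \<open>G\<close> must dominate both the integral norm,
    \<open>6 * pi\<^sup>2 * \<psi> n\<close>, and the uniform bound divided by \<open>m\<close>,
    \<open>5 * \<psi> n\<close>.\<close>
  define G where "G = 6 * (1 + pi\<^sup>2) * \<psi> n"
  have \<psi>n: "0 \<le> \<psi> n" by (simp add: psi_nonneg)
  obtain a0 \<phi> where \<phi>: "\<phi> \<in> B0 p" and fe: "AE x in lborel. f x = a0 / 2 + 1 / pi * (LINT t:?S|lborel. Psi \<psi> \<beta> (x - t) * \<phi> t)"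
    and fc: "continuous_on UNIV f"
    using f by (auto simp: C_class_def L_class_def)
  have \<phi>i: "set_integrable lborel ?S \<phi>"
    using \<phi> by (intro set_integrable_periodic_shift) (auto simp: B0_def)
  obtain d where d: "\<And>u. Psi \<psi> \<beta> u = Ker ?\<theta> u + (\<Sum>k<n. d k * cos (real k * u - ?\<theta>))"
    using Psi_minus_Ker by blast
  define Q where "Q x = (LINT t:?S|lborel. (\<Sum>k<n. d k * cos (real k * (x - t) - ?\<theta>)) * \<phi> t)" for x
  define T where "T x = a0 / 2 + 1 / pi * Q x" for x
  have Q: "(\<lambda>x. 1 / pi * Q x) \<in> trig_polys n"
  proof -
    have "(\<lambda>x. LINT t:?S|lborel. (\<Sum>k<n. (1 / pi * d k) * cos (real k * (x - t) - ?\<theta>)) * \<phi> t) \<in> trig_polys n"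
      by (rule convolution_trig_poly[OF \<phi>i])
    moreover have "(LINT t:?S|lborel. (\<Sum>k<n. (1 / pi * d k) * cos (real k * (x - t) - ?\<theta>)) * \<phi> t) = 1 / pi * Q x" for x
      unfolding Q_def set_integral_mult_right[symmetric]
      by (simp only: sum_distrib_left sum_distrib_right mult.assoc)
    ultimately show ?thesis by simp
  qed
  then have T: "T \<in> trig_polys n"
    unfolding T_def using const_trig_poly_add[OF Q n] by simp
  have K: "\<bar>LINT t:?S|lborel. Ker ?\<theta> (x - t) * \<phi> t\<bar> \<le> G * m powr inv_p p" for x
  proof (rule convolution_bound[OF Ker_continuous Ker_periodic _ _ _ _ p \<phi>])
    have "5 * m * \<psi> n \<le> (6 * m) * \<psi> n" using m(2) \<psi>n by (intro mult_right_mono) auto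
    also have "\<dots> \<le> 6 * (1 + pi\<^sup>2) * \<psi> n * m" using m(2) \<psi>n by (simp add: algebra_simps)
    finally show "\<bar>Ker ?\<theta> t\<bar> \<le> G * m" for t
      using Ker_bound[of ?\<theta> t] unfolding G_def by linarith
    show "integral {-pi..pi} (\<lambda>t. \<bar>Ker ?\<theta> t\<bar>) \<le> G"
      using integral_Ker_le[of ?\<theta>] \<psi>n unfolding G_def by (simp add: algebra_simps)
  qed (use m \<psi>n in \<open>auto simp: G_def\<close>)
  have split: "(LINT t:?S|lborel. Psi \<psi> \<beta> (x - t) * \<phi> t) = (LINT t:?S|lborel. Ker ?\<theta> (x - t) * \<phi> t) + Q x" for x
  proof -
    have i1: "set_integrable lborel ?S (\<lambda>t. Ker ?\<theta> (x - t) * \<phi> t)"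
      by (rule set_integrable_bounded_continuous_mult[OF _ Ker_bound \<phi>i])
         (auto intro!: continuous_on_compose2[OF Ker_continuous] continuous_intros)
    have "\<bar>\<Sum>k<n. d k * cos (real k * (x - t) - ?\<theta>)\<bar> \<le> (\<Sum>k<n. \<bar>d k\<bar>)" for t
      by (intro order.trans[OF sum_abs] sum_mono) (auto simp: abs_mult mult_left_le)
    then have i2: "set_integrable lborel ?S (\<lambda>t. (\<Sum>k<n. d k * cos (real k * (x - t) - ?\<theta>)) * \<phi> t)"
      by (intro set_integrable_bounded_continuous_mult[OF _ _ \<phi>i]) (auto intro!: continuous_intros)
    show ?thesis unfolding d Q_def distrib_right by (rule set_integral_add(2)[OF i1 i2])
  qed
  have "AE x in lborel. \<bar>f x - T x\<bar> \<le> 1 / pi * (G * m powr inv_p p)"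
    using fe
  proof eventually_elim
    case (elim x)
    have "f x - T x = 1 / pi * (LINT t:?S|lborel. Ker ?\<theta> (x - t) * \<phi> t)"
      unfolding elim T_def split by (simp add: algebra_simps)
    then have "\<bar>f x - T x\<bar> = 1 / pi * \<bar>LINT t:?S|lborel. Ker ?\<theta> (x - t) * \<phi> t\<bar>"
      by (simp add: abs_mult)
    also have "\<dots> \<le> 1 / pi * (G * m powr inv_p p)"
      by (intro mult_left_mono K) auto
    finally show ?case .
  qed
  then have "\<bar>f x - T x\<bar> \<le> 1 / pi * (G * m powr inv_p p)" for x
    by (rule AE_continuous_le[rotated]) (intro continuous_intros fc trig_polys_continuous[OF T])
  then show thesis
    using that[OF T] by (simp add: G_def mult_ac)
qed

lemma E_approx_upper:
  assumes "1 \<le> p"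
  shows "E_approx n (C_class \<psi> \<beta> p) \<le> ereal (6 * (1 + pi\<^sup>2) / pi * \<psi> n * m powr inv_p p)"
  unfolding E_approx_def
proof (rule SUP_least)
  fix f assume "f \<in> C_class \<psi> \<beta> p"
  from C_class_approximation[OF assms this] obtain T where "T \<in> trig_polys n"
    "\<And>x. \<bar>f x - T x\<bar> \<le> 6 * (1 + pi\<^sup>2) / pi * \<psi> n * m powr inv_p p" by blast
  then show "(INF T\<in>trig_polys n. SUP x. ereal \<bar>f x - T x\<bar>) \<le> ereal (6 * (1 + pi\<^sup>2) / pi * \<psi> n * m powr inv_p p)"
    by (intro INF_lower2[of T] SUP_least) auto
qed

end

subsection \<open>Lower bound\<close>

text \<open>The frequency is an integer rather than a natural number because product-to-sum formulas
  produce the difference of two frequencies.\<close>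

lemma has_integral_cos_period:
  assumes "k \<noteq> (0::int)"
  shows "((\<lambda>x. cos (of_int k * x - \<theta>)) has_integral 0) {a..a + 2 * pi}"
proof -
  define F where "F x = sin (of_int k * x - \<theta>) / of_int k" for x :: real
  have "((\<lambda>x. cos (of_int k * x - \<theta>)) has_integral (F (a + 2 * pi) - F a)) {a..a + 2 * pi}"
    using assms unfolding F_def
    by (intro fundamental_theorem_of_calculus)
       (auto intro!: derivative_eq_intros simp flip: has_real_derivative_iff_has_vector_derivative)
  moreover have "F (a + 2 * pi) = F a"
  proof -
    have "sin (of_int k * (a + 2 * pi) - \<theta>) = sin ((of_int k * a - \<theta>) + 2 * pi * of_int k)"
      by (simp add: algebra_simps)
    also have "\<dots> = sin (of_int k * a - \<theta>)"
      by (simp only: sin_add sin_int_2pin cos_int_2pin mult_zero_right mult_1_right add_0_right)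
    finally show ?thesis by (simp add: F_def)
  qed
  ultimately show ?thesis by simp
qed

text \<open>By the product-to-sum formula; the sum frequency is nonzero because of
  \<open>1 \<le> k\<close>, so only a vanishing difference frequency contributes.\<close>

lemma has_integral_cos_cos:
  fixes j k :: nat
  assumes "1 \<le> k"
  shows "((\<lambda>x. cos (real j * x - \<theta>) * cos (real k * x - \<alpha>)) has_integral
    (if j = k then pi * cos (\<theta> - \<alpha>) else 0)) {a..a + 2 * pi}"
proof -
  have 1: "((\<lambda>x. cos (of_int (int j + int k) * x - (\<theta> + \<alpha>))) has_integral 0) {a..a + 2 * pi}"
    using assms by (intro has_integral_cos_period) auto
  have 2: "((\<lambda>x. cos (of_int (int j - int k) * x - (\<theta> - \<alpha>))) has_integral
      (if j = k then 2 * pi * cos (\<theta> - \<alpha>) else 0)) {a..a + 2 * pi}"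
  proof (cases "j = k")
    case True
    have "cos (- (\<theta> - \<alpha>)) = cos (\<theta> - \<alpha>)" by (rule cos_minus)
    then show ?thesis using True has_integral_const_real[of "cos (\<theta> - \<alpha>)" a "a + 2 * pi"] by simp
  next
    case False
    then show ?thesis by (simp only: if_False) (intro has_integral_cos_period, auto)
  qed
  have eq: "cos (real j * x - \<theta>) * cos (real k * x - \<alpha>) =
      (cos (of_int (int j - int k) * x - (\<theta> - \<alpha>)) + cos (of_int (int j + int k) * x - (\<theta> + \<alpha>))) / 2" for x
    unfolding cos_times_cos by (simp add: algebra_simps)
  show ?thesis
    unfolding eq using has_integral_divide[OF has_integral_add[OF 2 1], of 2] by (simp split: if_splits)
qed

text \<open>\<open>R\<close> is the Fejer kernel \<open>\<bar>\<Sum>j<M. exp (i j x)\<bar>\<^sup>2\<close>; the coefficient \<open>c k\<close> counts the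
  pairs \<open>j, l < M\<close> with \<open>n + M + j - l = k\<close>.\<close>

lemma modulated_Fejer_kernel:
  assumes M: "1 \<le> M"
  obtains c :: "nat \<Rightarrow> real" and R :: "real \<Rightarrow> real"
  where "\<And>k. 0 \<le> c k" "(\<Sum>k\<in>{n..<n+2*M}. c k) = (real M)\<^sup>2"
    "continuous_on UNIV R" "\<And>x. 0 \<le> R x" "\<And>x. R x \<le> (real M)\<^sup>2"
    "\<And>a. (R has_integral 2 * pi * real M) {a..a + 2 * pi}"
    "\<And>x \<theta>. (\<Sum>k\<in>{n..<n+2*M}. c k * cos (real k * x - \<theta>)) = R x * cos (real (n + M) * x - \<theta>)"
proof -
  define P where "P = {..<M} \<times> {..<M}"
  \<comment> \<open>\<open>l < M\<close> makes the truncated subtraction exact and keeps the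
    frequencies inside \<open>{n..<n+2*M}\<close>.\<close>
  define h where "h = (\<lambda>(j, l). n + M + j - l)"
  define c where "c k = (\<Sum>q\<in>{q \<in> P. h q = k}. 1 :: real)" for k
  define C where "C x = (\<Sum>j<M. cos (real j * x))" for x
  define S where "S x = (\<Sum>j<M. sin (real j * x))" for x
  define R where "R x = (C x)\<^sup>2 + (S x)\<^sup>2" for x
  have P: "finite P" "h ` P \<subseteq> {n..<n+2*M}" by (auto simp: P_def h_def)
  have group: "(\<Sum>k\<in>{n..<n+2*M}. c k * f k) = (\<Sum>q\<in>P. f (h q))" for f :: "nat \<Rightarrow> real"
  proof -
    have "(\<Sum>k\<in>{n..<n+2*M}. c k * f k) = (\<Sum>k\<in>{n..<n+2*M}. \<Sum>q\<in>{q \<in> P. h q = k}. f (h q))"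
      unfolding c_def sum_distrib_right by (intro sum.cong) auto
    also have "\<dots> = (\<Sum>q\<in>P. f (h q))" using P by (intro sum.group) auto
    finally show ?thesis .
  qed
  \<comment> \<open>Real and imaginary part of an exponential sum times its conjugate: the sines
    cancel when \<open>j\<close> and \<open>l\<close> are exchanged.\<close>
  have CS: "(\<Sum>j<M. \<Sum>l<M. cos (real j * x - real l * x)) = R x"
    "(\<Sum>j<M. \<Sum>l<M. sin (real j * x - real l * x)) = 0" for x
  proof -
    show "(\<Sum>j<M. \<Sum>l<M. cos (real j * x - real l * x)) = R x"
      unfolding R_def C_def S_def power2_eq_square sum_product cos_diff sum.distrib ..
    have "(\<Sum>j<M. \<Sum>l<M. sin (real j * x - real l * x)) = S x * C x - C x * S x"
      unfolding C_def S_def sum_product sin_diff sum_subtractf ..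
    then show "(\<Sum>j<M. \<Sum>l<M. sin (real j * x - real l * x)) = 0" by simp
  qed
  show thesis
  proof (rule that[of c R])
    show "0 \<le> c k" for k by (simp add: c_def)
    show "(\<Sum>k\<in>{n..<n+2*M}. c k) = (real M)\<^sup>2"
      using group[of "\<lambda>_. 1"] by (simp add: P_def power2_eq_square)
    show "continuous_on UNIV R" unfolding R_def C_def S_def by (intro continuous_intros)
    show "0 \<le> R x" for x by (simp add: R_def)
    show "R x \<le> (real M)\<^sup>2" for x
    proof -
      have "R x \<le> (\<Sum>j<M. \<Sum>l<M. 1)" unfolding CS(1)[symmetric] by (intro sum_mono) auto
      then show ?thesis by (simp add: power2_eq_square)
    qed
    show "(R has_integral 2 * pi * real M) {a..a + 2 * pi}" for a
    proof -
      have "((\<lambda>x. cos (of_int (int j - int l) * x - 0)) has_integral (if j = l then 2 * pi else 0)) {a..a + 2 * pi}" for j l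
      proof (cases "j = l")
        case True
        then show ?thesis using has_integral_const_real[of "1::real" a "a + 2 * pi"] by simp
      next
        case False
        then show ?thesis by (simp only: if_False) (intro has_integral_cos_period, auto)
      qed
      then have "((\<lambda>x. \<Sum>j<M. \<Sum>l<M. cos (of_int (int j - int l) * x - 0)) has_integral
          (\<Sum>j<M. \<Sum>l<M. if j = l then 2 * pi else 0)) {a..a + 2 * pi}"
        by (intro has_integral_sum) auto
      moreover have "(\<Sum>j<M. \<Sum>l<M. cos (of_int (int j - int l) * x - 0)) = R x" for x
        unfolding CS(1)[symmetric] by (simp add: left_diff_distrib)
      ultimately show ?thesis by (simp add: mult.commute)
    qed
    show "(\<Sum>k\<in>{n..<n+2*M}. c k * cos (real k * x - \<theta>)) = R x * cos (real (n + M) * x - \<theta>)" for x \<theta>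
    proof -
      define A where "A = real (n + M) * x - \<theta>"
      have "(\<Sum>k\<in>{n..<n+2*M}. c k * cos (real k * x - \<theta>)) = (\<Sum>q\<in>P. cos (real (h q) * x - \<theta>))"
        by (rule group)
      also have "\<dots> = (\<Sum>j<M. \<Sum>l<M. cos (real (h (j, l)) * x - \<theta>))"
        unfolding P_def by (simp add: sum.cartesian_product)
      also have "\<dots> = (\<Sum>j<M. \<Sum>l<M. cos (A + (real j * x - real l * x)))"
        by (intro sum.cong refl arg_cong[where f = cos]) (auto simp: h_def A_def of_nat_diff algebra_simps)
      also have "\<dots> = cos A * R x - sin A * 0"
        unfolding cos_add sum_subtractf sum_distrib_left[symmetric] CS ..
      finally show ?thesis by (simp add: A_def mult.commute)
    qed
  qed
qed

lemma has_integral_cos_poly_mult: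
  assumes "1 \<le> n" "finite K" "\<And>k. k \<in> K \<Longrightarrow> n \<le> k" "finite J"
  shows "((\<lambda>x. (\<Sum>j\<in>J. d j * cos (real j * x - \<theta> j)) * (\<Sum>k\<in>K. c k * cos (real k * x - \<alpha>))) has_integral
    (\<Sum>j\<in>J. \<Sum>k\<in>K. d j * c k * (if j = k then pi * cos (\<theta> j - \<alpha>) else 0))) {a..a + 2 * pi}"
proof -
  have "((\<lambda>x. \<Sum>j\<in>J. \<Sum>k\<in>K. d j * c k * (cos (real j * x - \<theta> j) * cos (real k * x - \<alpha>))) has_integral
    (\<Sum>j\<in>J. \<Sum>k\<in>K. d j * c k * (if j = k then pi * cos (\<theta> j - \<alpha>) else 0))) {a..a + 2 * pi}"
    using assms by (intro has_integral_sum has_integral_mult_right has_integral_cos_cos) force+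
  moreover have "(\<Sum>j\<in>J. d j * cos (real j * x - \<theta> j)) * (\<Sum>k\<in>K. c k * cos (real k * x - \<alpha>)) =
      (\<Sum>j\<in>J. \<Sum>k\<in>K. d j * c k * (cos (real j * x - \<theta> j) * cos (real k * x - \<alpha>)))" for x
    unfolding sum_product by (intro sum.cong refl) simp
  ultimately show ?thesis by simp
qed

text \<open>Sines are written as cosines with phase \<open>pi / 2\<close>, so one product formula
  serves both; frequencies below \<open>n\<close> never meet those in \<open>K\<close>.\<close>

lemma trig_poly_orthogonal:
  assumes T: "T \<in> trig_polys n" and n: "1 \<le> n" "finite K" "\<And>k. k \<in> K \<Longrightarrow> n \<le> k"
  shows "((\<lambda>x. T x * (\<Sum>k\<in>K. c k * cos (real k * x - \<alpha>))) has_integral 0) {a..a + 2 * pi}"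
proof -
  obtain A B where Tx: "\<And>x. T x = (\<Sum>k<n. A k * cos (real k * x) + B k * sin (real k * x))"
    using T by (auto simp: trig_polys_def)
  have cs: "T x = (\<Sum>k<n. A k * cos (real k * x - 0)) + (\<Sum>k<n. B k * cos (real k * x - pi / 2))" for x
    unfolding Tx by (simp add: sum.distrib cos_diff)
  have z: "(\<Sum>j<n. \<Sum>k\<in>K. d j * c k * (if j = k then pi * cos (\<theta> - \<alpha>) else 0)) = 0" for d \<theta>
    using n(3) by (intro sum.neutral ballI) force
  have "((\<lambda>x. (\<Sum>k<n. A k * cos (real k * x - 0)) * (\<Sum>k\<in>K. c k * cos (real k * x - \<alpha>)) +
     (\<Sum>k<n. B k * cos (real k * x - pi / 2)) * (\<Sum>k\<in>K. c k * cos (real k * x - \<alpha>))) has_integral 0 + 0) {a..a + 2 * pi}"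
    using has_integral_cos_poly_mult[OF n, of "{..<n}" A "\<lambda>_. 0" c \<alpha> a, unfolded z]
      has_integral_cos_poly_mult[OF n, of "{..<n}" B "\<lambda>_. pi / 2" c \<alpha> a, unfolded z]
    by (intro has_integral_add) auto
  then show ?thesis unfolding cs by (simp add: distrib_right)
qed

section \<open>Continuity and Fourier coefficients of \<open>Psi\<close>\<close>

context psi_at
begin

lemma Psi_continuous: "continuous_on UNIV (Psi \<psi> \<beta>)"
  unfolding Psi_eq by (rule continuous_cos_series[OF summable_psi psi_Suc_nonneg])

text \<open>Summability of \<open>\<psi>\<close> makes the series uniformly convergent, so it may be
  integrated term by term, and orthogonality leaves frequency \<open>k\<close> alone.\<close>

lemma has_integral_Psi_cos:
  assumes k: "1 \<le> k"
  shows "((\<lambda>t. Psi \<psi> \<beta> (x - t) * cos (real k * t)) has_integral pi * \<psi> k * cos (real k * x - \<beta> * pi / 2)) {-pi..pi}"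
proof -
  let ?\<theta> = "\<beta> * pi / 2"
  let ?f = "\<lambda>j t. \<psi> (real (Suc j)) * cos (real (Suc j) * (x - t) - ?\<theta>) * cos (real k * t)"
  have s: "summable (\<lambda>j. \<psi> (real (Suc j)))"
    using summable_psi summable_Suc_iff[of "\<lambda>k. \<psi> (real k)"] by simp
  have le: "norm (?f j t) \<le> \<psi> (real (Suc j))" for j t
  proof -
    have "\<bar>cos (real (Suc j) * (x - t) - ?\<theta>) * cos (real k * t)\<bar> \<le> 1 * 1"
      unfolding abs_mult by (intro mult_mono) auto
    then have "\<psi> (real (Suc j)) * \<bar>cos (real (Suc j) * (x - t) - ?\<theta>) * cos (real k * t)\<bar> \<le> \<psi> (real (Suc j)) * 1"
      using psi_Suc_nonneg by (intro mult_left_mono) auto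
    then show ?thesis using psi_Suc_nonneg[of j] by (simp add: abs_mult mult.assoc)
  qed
  have "uniform_limit {-pi..pi} (\<lambda>N t. \<Sum>j<N. ?f j t) (\<lambda>t. \<Sum>j. ?f j t) sequentially"
    by (rule Weierstrass_m_test[OF le s])
  then obtain I J where I: "\<And>N. ((\<lambda>t. \<Sum>j<N. ?f j t) has_integral I N) {-pi..pi}"
    and J: "((\<lambda>t. \<Sum>j. ?f j t) has_integral J) {-pi..pi}" and lim: "I \<longlonglongrightarrow> J"
    by (rule uniform_limit_integral) (auto intro!: continuous_intros)
  have fj: "(?f j has_integral (if Suc j = k then pi * \<psi> k * cos (real k * x - ?\<theta>) else 0)) {-pi..pi}" for j
  proof -
    have "((\<lambda>t. cos (real (Suc j) * t - (real (Suc j) * x - ?\<theta>)) * cos (real k * t - 0)) has_integral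
        (if Suc j = k then pi * cos (real (Suc j) * x - ?\<theta> - 0) else 0)) {-pi..-pi + 2 * pi}"
      by (rule has_integral_cos_cos[OF k])
    moreover have "cos (real (Suc j) * t - (real (Suc j) * x - ?\<theta>)) = cos (real (Suc j) * (x - t) - ?\<theta>)" for t
      by (subst cos_minus[symmetric]) (simp only: minus_diff_eq right_diff_distrib diff_diff_eq add.commute diff_diff_eq2)
    ultimately have "((\<lambda>t. cos (real (Suc j) * (x - t) - ?\<theta>) * cos (real k * t)) has_integral
        (if Suc j = k then pi * cos (real (Suc j) * x - ?\<theta>) else 0)) {-pi..pi}"
      by (auto simp del: of_nat_Suc split: if_splits)
    from has_integral_mult_right[OF this, of "\<psi> (real (Suc j))"]
    show ?thesis by (simp add: mult_ac del: of_nat_Suc split: if_splits)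
  qed
  \<comment> \<open>Term \<open>j\<close> carries frequency \<open>Suc j\<close>, so the partial
    integrals are constant from \<open>N = k\<close> on.\<close>
  have IN: "I N = pi * \<psi> k * cos (real k * x - ?\<theta>)" if "N \<ge> k" for N
  proof -
    obtain i where i: "k = Suc i" using k by (cases k) auto
    have "((\<lambda>t. \<Sum>j<N. ?f j t) has_integral (\<Sum>j<N. if Suc j = k then pi * \<psi> k * cos (real k * x - ?\<theta>) else 0)) {-pi..pi}"
      by (intro has_integral_sum fj) auto
    with I[of N] have "I N = (\<Sum>j<N. if Suc j = k then pi * \<psi> k * cos (real k * x - ?\<theta>) else 0)"
      by (rule has_integral_unique)
    also have "\<dots> = pi * \<psi> k * cos (real k * x - ?\<theta>)"
      using that unfolding i by (simp del: of_nat_Suc add: if_distrib sum.delta)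
    finally show ?thesis .
  qed
  have "I \<longlonglongrightarrow> pi * \<psi> k * cos (real k * x - ?\<theta>)"
    by (rule tendsto_eventually) (auto intro!: eventually_mono[OF eventually_ge_at_top[of k]] IN)
  then have "J = pi * \<psi> k * cos (real k * x - ?\<theta>)"
    using LIMSEQ_unique[OF lim] by simp
  moreover have "(\<Sum>j. ?f j t) = Psi \<psi> \<beta> (x - t) * cos (real k * t)" for t
    unfolding Psi_eq cos_series_def
    by (rule suminf_mult2[symmetric])
       (rule summable_cos_series[OF summable_psi], rule psi_Suc_nonneg)
  ultimately show ?thesis using J by simp
qed

end

text \<open>Since \<open>R / M\<^sup>2\<close> lies between 0 and 1, its power with exponent
  \<open>q \<ge> 1\<close> is at most itself and has integral at most \<open>2 * pi / M\<close>.
  Hence the norm of \<open>V\<close> is at most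
  \<open>M\<^sup>2 * (2 * pi / M) powr (1 / q)\<close>. The divisor has \<open>2 * pi\<close> in
  place of its root, which also covers the infinite exponent.\<close>

lemma normalized_kernel_in_B0:
  fixes R V :: "real \<Rightarrow> real"
  assumes p: "1 \<le> p" and M: "1 \<le> M"
    and R: "continuous_on UNIV R" "\<And>x. R x \<le> M\<^sup>2" "(R has_integral 2 * pi * M) {0..2 * pi}"
    and V: "continuous_on UNIV V" "periodic_2pi V" "\<And>x. \<bar>V x\<bar> \<le> R x" "(V has_integral 0) {0..2 * pi}"
  shows "(\<lambda>t. V t / (2 * pi * M\<^sup>2 / M powr inv_p p)) \<in> B0 p"
proof -
  let ?I = "{0..2 * pi}"
  define C where "C = 2 * pi * M\<^sup>2 / M powr inv_p p"
  \<comment> \<open>\<open>w\<close> is \<open>M\<^sup>2 / C\<close>: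
    \<open>\<bar>\<phi>\<bar>\<close> is at most \<open>w\<close> times the kernel rescaled to
    height at most 1.\<close>
  define w where "w = M powr inv_p p / (2 * pi)"
  have M0: "M > 0" using M by simp
  have C: "C > 0" using M0 by (simp add: C_def)
  define \<phi> where "\<phi> t = V t / C" for t
  have \<phi>c: "continuous_on S \<phi>" for S
    unfolding \<phi>_def using C by (intro continuous_intros continuous_on_subset[OF V(1)]) auto
  have R0: "0 \<le> R x" for x using V(3)[of x] by simp
  have \<phi>R: "\<bar>\<phi> t\<bar> \<le> R t / M\<^sup>2 * w" for t
  proof -
    have "\<bar>\<phi> t\<bar> \<le> R t / C"
      using V(3)[of t] C by (simp add: \<phi>_def divide_right_mono)
    also have "\<dots> = R t / M\<^sup>2 * w" using M0 by (simp add: C_def w_def)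
    finally show ?thesis .
  qed
  have R1: "0 \<le> R t / M\<^sup>2" "R t / M\<^sup>2 \<le> 1" for t
    using R0[of t] R(2)[of t] M0 by (auto simp: divide_le_eq)
  have w0: "0 \<le> w" by (simp add: w_def)
  have "(\<phi> has_integral 0 / C) ?I" unfolding \<phi>_def by (rule has_integral_divide[OF V(4)])
  then have int0: "(LINT t:?I|lborel. \<phi> t) = 0"
    by (simp add: set_borel_integral_continuous[OF \<phi>c] integral_unique)
  have "if p = \<infinity> then (AE t in lborel. t \<in> {0..2*pi} \<longrightarrow> \<bar>\<phi> t\<bar> \<le> 1)
      else set_integrable lborel {0..2*pi} (\<lambda>t. \<bar>\<phi> t\<bar> powr real_of_ereal p) \<and>
           (LINT t:{0..2*pi}|lborel. \<bar>\<phi> t\<bar> powr real_of_ereal p) powr (1 / real_of_ereal p) \<le> 1"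
  proof (cases p)
    case PInf
    have "w \<le> 1" using M0 pi_ge_two PInf by (simp add: w_def inv_p_def)
    then have "R t / M\<^sup>2 * w \<le> 1 * 1" for t using R1 w0 by (intro mult_mono) auto
    then have "\<bar>\<phi> t\<bar> \<le> 1" for t using \<phi>R[of t] by (simp add: order_trans)
    then show ?thesis using PInf by simp
  next
    case (real q)
    then have q: "1 \<le> q" using p by simp
    have c: "continuous_on ?I (\<lambda>t. \<bar>\<phi> t\<bar> powr q)"
      using q by (intro continuous_on_powr' continuous_intros \<phi>c) auto
    have wq: "w powr q \<le> M / (2 * pi)"
    proof -
      have "w powr q = M / (2 * pi) powr q"
        using q M0 real by (simp add: w_def powr_divide powr_powr inv_p_ereal)
      also have "\<dots> \<le> M / (2 * pi) powr 1"
        using q M0 pi_ge_two by (intro divide_left_mono powr_mono) auto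
      finally show ?thesis by simp
    qed
    have le: "\<bar>\<phi> t\<bar> powr q \<le> R t * (1 / (2 * pi * M))" for t
    proof -
      have "\<bar>\<phi> t\<bar> powr q \<le> (R t / M\<^sup>2 * w) powr q"
        using \<phi>R q by (intro powr_mono2) auto
      also have "\<dots> = (R t / M\<^sup>2) powr q * w powr q"
        by (rule powr_mult)
      also have "\<dots> \<le> (R t / M\<^sup>2) * (M / (2 * pi))"
      proof (intro mult_mono wq)
        show "(R t / M\<^sup>2) powr q \<le> R t / M\<^sup>2"
        proof (cases "R t / M\<^sup>2 = 0")
          case False
          then have "(R t / M\<^sup>2) powr q \<le> (R t / M\<^sup>2) powr 1"
            using R1[of t] q by (intro powr_mono') auto
          then show ?thesis using R1(1)[of t] by (simp only: powr_one)
        qed (simp only: powr_0)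
      qed (use R1 in simp_all)
      also have "\<dots> = R t * (1 / (2 * pi * M))" using M0 by (simp add: power2_eq_square)
      finally show ?thesis .
    qed
    have "integral ?I (\<lambda>t. \<bar>\<phi> t\<bar> powr q) \<le> 2 * pi * M * (1 / (2 * pi * M))"
      using le by (intro has_integral_le[OF integrable_integral[OF integrable_continuous_real[OF c]] has_integral_mult_left[OF R(3)]])
    then have "integral ?I (\<lambda>t. \<bar>\<phi> t\<bar> powr q) \<le> 1" using M0 by simp
    moreover have "0 \<le> integral ?I (\<lambda>t. \<bar>\<phi> t\<bar> powr q)"
      by (intro integral_nonneg integrable_continuous_real c) auto
    ultimately have "(LINT t:?I|lborel. \<bar>\<phi> t\<bar> powr q) powr (1 / q) \<le> 1"
      unfolding set_borel_integral_continuous[OF c] using q by (intro powr_le1) auto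
    then show ?thesis using real borel_integrable_atLeastAtMost'[OF c] by simp
  qed (use p in auto)
  moreover have "periodic_2pi \<phi>" using V(2) by (simp add: periodic_2pi_def \<phi>_def)
  moreover have "\<phi> \<in> borel_measurable lborel"
    using borel_measurable_continuous_onI[OF \<phi>c] by simp
  ultimately have "\<phi> \<in> B0 p"
    unfolding B0_def using int0 borel_integrable_atLeastAtMost'[OF \<phi>c] by simp
  then show ?thesis unfolding \<phi>_def C_def .
qed

section \<open>The hard function and the duality argument\<close>

context psi_at
begin

text \<open>Duality: integrating \<open>f - T\<close> against \<open>V ?\<theta>\<close> removes
  \<open>T\<close>, and the integral of \<open>\<bar>V ?\<theta>\<bar>\<close> is at most
  \<open>2 * pi * real M\<close>, so the error \<open>s\<close> is at least the integral of
  \<open>f * V ?\<theta>\<close> divided by that number. This gives \<open>16 * pi\<close> in terms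
  of \<open>M\<close>, and \<open>64 * pi\<close> after returning to \<open>m\<close>.\<close>

lemma hard_function:
  assumes p: "1 \<le> p"
  obtains f where "f \<in> C_class \<psi> \<beta> p"
    "\<And>T s. T \<in> trig_polys n \<Longrightarrow> (\<And>x. \<bar>f x - T x\<bar> \<le> s) \<Longrightarrow> \<psi> n * m powr inv_p p / (64 * pi) \<le> s"
proof -
  let ?\<theta> = "\<beta> * pi / 2"
  define q where "q = inv_p p"
  have q: "0 \<le> q" "q \<le> 1"
    using p by (cases p; simp add: q_def inv_p_def)+
  \<comment> \<open>Half of \<open>m\<close>, because the kernel occupies \<open>2 * M\<close>
    frequencies, which must not pass \<open>eta \<psi> n = n + m\<close>.\<close>
  define M where "M = nat \<lfloor>m / 2\<rfloor>"
  have "1 \<le> \<lfloor>m / 2\<rfloor>" using m(2) by linarith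
  then have Mr: "real M = of_int \<lfloor>m / 2\<rfloor>" and M1: "1 \<le> M" unfolding M_def by (auto simp: le_nat_iff)
  have M2: "2 * real M \<le> m" "m / 4 \<le> real M"
    using M1 real_of_int_floor_gt_diff_one[of "m / 2"] of_int_floor_le[of "m / 2"] unfolding Mr[symmetric] by linarith+
  have M0: "0 < real M" using M1 by simp
  define K where "K = {n..<n + 2 * M}"
  have K: "finite K" "\<And>k. k \<in> K \<Longrightarrow> n \<le> k" "\<And>k. k \<in> K \<Longrightarrow> 1 \<le> k" using n by (auto simp: K_def)
  obtain c :: "nat \<Rightarrow> real" and R :: "real \<Rightarrow> real" where c: "\<And>k. 0 \<le> c k" "(\<Sum>k\<in>K. c k) = (real M)\<^sup>2"
    and R: "continuous_on UNIV R" "\<And>x. 0 \<le> R x" "\<And>x. R x \<le> (real M)\<^sup>2"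
      "\<And>a. (R has_integral 2 * pi * real M) {a..a + 2 * pi}"
    and cR: "\<And>x \<theta>. (\<Sum>k\<in>K. c k * cos (real k * x - \<theta>)) = R x * cos (real (n + M) * x - \<theta>)"
  proof (rule modulated_Fejer_kernel[OF M1, of n, folded K_def], goal_cases)
    case (1 c R)
    then show ?case by (intro that[of c R])
  qed
  define V where "V \<theta> x = (\<Sum>k\<in>K. c k * cos (real k * x - \<theta>))" for \<theta> x
  have VR: "\<bar>V \<theta> x\<bar> \<le> R x" for \<theta> x
    unfolding V_def cR abs_mult using R(2)[of x] by (simp add: mult_left_le)
  define C where "C = 2 * pi * (real M)\<^sup>2 / real M powr q"
  have C: "C > 0" using M0 by (simp add: C_def)
  define \<phi> where "\<phi> t = V 0 t / C" for t
  \<comment> \<open>Convolution with \<open>Psi\<close> multiplies coefficients by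
    \<open>\<psi> k\<close> and shifts the phase by \<open>?\<theta>\<close>. Testing against the
    kernel with the same phase makes every diagonal term nonnegative.\<close>
  define f where "f x = (\<Sum>k\<in>K. c k * \<psi> k * cos (real k * x - ?\<theta>)) / C" for x
  have "(V 0 has_integral 0) {0..0 + 2 * pi}"
  proof -
    have "((\<lambda>x. \<Sum>k\<in>K. c k * cos (real k * x - 0)) has_integral (\<Sum>k\<in>K. c k * 0)) {0..0 + 2 * pi}"
    proof (intro has_integral_sum has_integral_mult_right K(1))
      fix k assume "k \<in> K"
      then show "((\<lambda>x. cos (real k * x - 0)) has_integral 0) {0..0 + 2 * pi}"
        using has_integral_cos_period[of "int k" 0 0] K(3) by force
    qed
    then show ?thesis by (simp add: V_def[abs_def])
  qed
  moreover have "continuous_on UNIV (V 0)" "periodic_2pi (V 0)"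
    unfolding V_def periodic_2pi_def cos_period_nat by (auto intro!: continuous_intros)
  ultimately have \<phi>B: "\<phi> \<in> B0 p"
    unfolding \<phi>_def C_def q_def using R(1,3) R(4)[of 0] M1 VR
    by (intro normalized_kernel_in_B0[where R = R] p) auto
  have f_eq: "f x = 0 / 2 + 1 / pi * (LINT t:{-pi..pi}|lborel. Psi \<psi> \<beta> (x - t) * \<phi> t)" for x
  proof -
    have "((\<lambda>t. (\<Sum>k\<in>K. c k * (Psi \<psi> \<beta> (x - t) * cos (real k * t))) / C) has_integral
        (\<Sum>k\<in>K. c k * (pi * \<psi> k * cos (real k * x - ?\<theta>))) / C) {-pi..pi}"
      by (intro has_integral_divide has_integral_sum has_integral_mult_right has_integral_Psi_cos K)
    moreover have "(\<Sum>k\<in>K. c k * (Psi \<psi> \<beta> (x - t) * cos (real k * t))) / C = Psi \<psi> \<beta> (x - t) * \<phi> t" for t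
      by (simp add: \<phi>_def V_def sum_distrib_left mult_ac)
    moreover have "(\<Sum>k\<in>K. c k * (pi * \<psi> k * cos (real k * x - ?\<theta>))) / C = pi * f x"
      by (simp add: f_def sum_distrib_left mult_ac)
    ultimately have "((\<lambda>t. Psi \<psi> \<beta> (x - t) * \<phi> t) has_integral pi * f x) {-pi..pi}" by simp
    moreover have "continuous_on {-pi..pi} (\<lambda>t. Psi \<psi> \<beta> (x - t) * \<phi> t)"
      unfolding \<phi>_def V_def using C
      by (intro continuous_intros continuous_on_compose2[OF Psi_continuous]) auto
    ultimately show ?thesis
      by (simp add: set_borel_integral_continuous integral_unique)
  qed
  have fc: "continuous_on S f" for S unfolding f_def using C by (intro continuous_intros) auto
  have "periodic_2pi f" by (simp add: periodic_2pi_def f_def cos_period_nat)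
  then have fC: "f \<in> C_class \<psi> \<beta> p"
    unfolding C_class_def L_class_def using f_eq fc \<phi>B by blast
  have "\<psi> n * m powr q / (64 * pi) \<le> s" if T: "T \<in> trig_polys n" and s: "\<And>x. \<bar>f x - T x\<bar> \<le> s" for T s
  proof -
    have Tc: "continuous_on UNIV T" by (rule trig_polys_continuous[OF T])
    have "((\<lambda>x. (\<Sum>k\<in>K. c k * \<psi> k * cos (real k * x - ?\<theta>)) * (\<Sum>k\<in>K. c k * cos (real k * x - ?\<theta>))) has_integral
       (\<Sum>j\<in>K. \<Sum>k\<in>K. c j * \<psi> j * c k * (if j = k then pi * cos (?\<theta> - ?\<theta>) else 0))) {0..0 + 2 * pi}"
      using has_integral_cos_poly_mult[OF n K(1,2,1), of "\<lambda>k. c k * \<psi> k" "\<lambda>_. ?\<theta>" c ?\<theta> 0] by simp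
    also have "(\<Sum>j\<in>K. \<Sum>k\<in>K. c j * \<psi> j * c k * (if j = k then pi * cos (?\<theta> - ?\<theta>) else 0)) = (\<Sum>k\<in>K. pi * \<psi> k * (c k)\<^sup>2)"
      using K(1) by (simp add: if_distrib sum.delta' power2_eq_square mult_ac cong: if_cong)
    finally have "((\<lambda>x. f x * V ?\<theta> x) has_integral (\<Sum>k\<in>K. pi * \<psi> k * (c k)\<^sup>2) / C) {0..0 + 2 * pi}"
      unfolding f_def V_def times_divide_eq_left by (rule has_integral_divide)
    from has_integral_diff[OF this trig_poly_orthogonal[OF T n K(1,2), of c ?\<theta> 0, folded V_def]]
    have I: "((\<lambda>x. (f x - T x) * V ?\<theta> x) has_integral (\<Sum>k\<in>K. pi * \<psi> k * (c k)\<^sup>2) / C) {0..0 + 2 * pi}"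
      by (simp add: left_diff_distrib)
    have "(f x - T x) * V ?\<theta> x \<le> s * R x" for x
    proof -
      have "(f x - T x) * V ?\<theta> x \<le> \<bar>f x - T x\<bar> * \<bar>V ?\<theta> x\<bar>" by (metis abs_ge_self abs_mult)
      also have "\<dots> \<le> s * R x" using s[of x] VR by (intro mult_mono) (auto intro: order_trans[OF abs_ge_zero])
      finally show ?thesis .
    qed
    then have upper: "(\<Sum>k\<in>K. pi * \<psi> k * (c k)\<^sup>2) / C \<le> s * (2 * pi * real M)"
      using has_integral_le[OF I has_integral_mult_right[OF R(4)[of 0], of s]] by simp
    have lower: "(\<Sum>k\<in>K. pi * \<psi> k * (c k)\<^sup>2) \<ge> pi * \<psi> n / 4 * real M ^ 3"
    proof -
      \<comment> \<open>Cauchy-Schwarz over the \<open>2 * M\<close> frequencies: only the sum of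
        the \<open>c k\<close> is needed, not their individual values.\<close>
      have "((real M)\<^sup>2)\<^sup>2 \<le> (\<Sum>k\<in>K. (c k)\<^sup>2) * real (2 * M)"
        using sum_squared_le_sum_of_squares[of c K] c(2) by (simp add: K_def)
      then have "real M ^ 3 * real M \<le> (2 * (\<Sum>k\<in>K. (c k)\<^sup>2)) * real M"
        by (simp add: power2_eq_square power3_eq_cube mult_ac)
      then have "real M ^ 3 \<le> 2 * (\<Sum>k\<in>K. (c k)\<^sup>2)" using M0 by simp
      then have "pi * \<psi> n / 4 * real M ^ 3 \<le> pi * \<psi> n / 4 * (2 * (\<Sum>k\<in>K. (c k)\<^sup>2))"
        by (intro mult_left_mono) (auto simp: psi_nonneg)
      also have "\<dots> = (\<Sum>k\<in>K. pi * (\<psi> n / 2) * (c k)\<^sup>2)"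
        by (simp add: sum_distrib_left mult.assoc)
      also have "\<dots> \<le> (\<Sum>k\<in>K. pi * \<psi> k * (c k)\<^sup>2)"
      proof (intro sum_mono mult_right_mono mult_left_mono)
        fix k assume k: "k \<in> K"
        have "k \<le> n + 2 * M" using k by (simp add: K_def)
        then have "real k \<le> eta \<psi> n" unfolding eta_n(2) using M2(1) by linarith
        then have "\<psi> (eta \<psi> n) \<le> \<psi> k" using K(3)[OF k] by (intro antimono) auto
        then show "\<psi> n / 2 \<le> \<psi> k" using class_M_eta(1)[OF M, of n] n by simp
      qed auto
      finally show ?thesis .
    qed
    have "\<psi> n * real M powr q / (16 * pi) * (2 * pi * real M) = pi * \<psi> n / 4 * real M ^ 3 / C"
      using M0 by (simp add: C_def power2_eq_square power3_eq_cube)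
    also have "\<dots> \<le> (\<Sum>k\<in>K. pi * \<psi> k * (c k)\<^sup>2) / C"
      using C by (intro divide_right_mono lower) simp
    also note upper
    finally have "\<psi> n * real M powr q / (16 * pi) * (2 * pi * real M) \<le> s * (2 * pi * real M)" .
    then have *: "\<psi> n * real M powr q / (16 * pi) \<le> s"
      by (rule mult_right_le_imp_le) (use M0 in simp)
    have "m powr q / 4 \<le> real M powr q"
    proof -
      \<comment> \<open>\<open>M\<close> is at least \<open>m / 4\<close>, and
        \<open>q \<le> 1\<close> limits the loss in the power to a factor 4.\<close>
      have "(4::real) powr q \<le> 4 powr 1" using q by (intro powr_mono) auto
      then have "m powr q / 4 \<le> m powr q / 4 powr q" by (intro divide_left_mono) auto
      also have "\<dots> = (m / 4) powr q" using m(2) by (simp add: powr_divide)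
      also have "\<dots> \<le> real M powr q" using q M2 m(2) by (intro powr_mono2) auto
      finally show ?thesis .
    qed
    then have "\<psi> n * (m powr q / 4) / (16 * pi) \<le> \<psi> n * real M powr q / (16 * pi)"
      by (intro divide_right_mono mult_left_mono) (auto simp: psi_nonneg)
    with * show ?thesis by simp
  qed
  with fC show thesis using that unfolding q_def by blast
qed

lemma E_approx_lower:
  assumes "1 \<le> p"
  shows "ereal (\<psi> n * m powr inv_p p / (64 * pi)) \<le> E_approx n (C_class \<psi> \<beta> p)"
proof -
  obtain f where f: "f \<in> C_class \<psi> \<beta> p"
    and le: "\<And>T s. T \<in> trig_polys n \<Longrightarrow> (\<And>x. \<bar>f x - T x\<bar> \<le> s) \<Longrightarrow> \<psi> n * m powr inv_p p / (64 * pi) \<le> s"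
    using hard_function[OF assms] by blast
  have "ereal (\<psi> n * m powr inv_p p / (64 * pi)) \<le> (INF T\<in>trig_polys n. SUP x. ereal \<bar>f x - T x\<bar>)"
  proof (rule INF_greatest)
    fix T assume T: "T \<in> trig_polys n"
    define S where "S = (SUP x. ereal \<bar>f x - T x\<bar>)"
    have S: "ereal \<bar>f x - T x\<bar> \<le> S" for x unfolding S_def by (rule SUP_upper) simp
    show "ereal (\<psi> n * m powr inv_p p / (64 * pi)) \<le> (SUP x. ereal \<bar>f x - T x\<bar>)"
      \<comment> \<open>A finite supremum is a legitimate error bound for \<open>le\<close>; an
        infinite one is trivial, and minus infinity is excluded by \<open>S\<close>.\<close>
      unfolding S_def[symmetric] using S le[OF T] by (cases S) auto
  qed
  then show ?thesis unfolding E_approx_def by (rule SUP_upper2[OF f])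
qed

end

section \<open>Comparison with the constants of the statement\<close>

lemma C_low_le:
  assumes "a > 2" shows "C_low a \<le> 1 / (64 * pi)"
proof -
  \<comment> \<open>The factor of \<open>C_low\<close> that depends on \<open>a\<close> is at most
    1, so it can be discarded.\<close>
  have "(a - 1)\<^sup>2 * (a - 2)\<^sup>2 \<le> a\<^sup>2 * (a * (3 * a - 4))"
  proof (intro mult_mono)
    have "(a - 2)\<^sup>2 \<le> a * (a - 2)" unfolding power2_eq_square using assms by (intro mult_right_mono) auto
    also have "\<dots> \<le> a * (3 * a - 4)" using assms by (intro mult_left_mono) auto
    finally show "(a - 2)\<^sup>2 \<le> a * (3 * a - 4)" .
  qed (use assms in \<open>auto intro: power_mono\<close>)
  also have "\<dots> = a ^ 3 * (3 * a - 4)" by (simp add: power2_eq_square power3_eq_cube)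
  finally have "(a - 1)\<^sup>2 * (a - 2)\<^sup>2 / (a ^ 3 * (3 * a - 4)) \<le> 1"
    using assms by (simp add: divide_le_eq)
  then have "C_low a \<le> pi / (96 * (1 + pi\<^sup>2)\<^sup>2) * 1"
    unfolding C_low_def by (intro mult_left_mono) auto
  also have "\<dots> \<le> 1 / (64 * pi)"
  proof -
    have "64 * pi\<^sup>2 \<le> 96 * (1 + pi\<^sup>2)" by simp
    also have "\<dots> \<le> 96 * (1 + pi\<^sup>2)\<^sup>2"
      using mult_right_mono[of 1 "1 + pi\<^sup>2" "1 + pi\<^sup>2"] by (simp add: power2_eq_square)
    finally show ?thesis
      by (simp add: field_simps power2_eq_square add_pos_nonneg)
  qed
  finally show ?thesis .
qed

text \<open>The two fractions in \<open>C_up\<close> stay above 2 and 1, their limits for large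
  \<open>b\<close> and \<open>a\<close>; the bracket is thus at least 3, and twice 3 is the 6 of the
  upper estimate.\<close>

lemma C_up_ge:
  assumes "a > 2" "b > 2" shows "6 * (1 + pi\<^sup>2) / pi \<le> C_up a b"
proof -
  have "2 \<le> 2 * b / (b - 2)" "1 \<le> a / (a - 1)" using assms by (auto simp: field_simps)
  then have "2 * (1 + pi\<^sup>2) / pi * 3 \<le> C_up a b"
    unfolding C_up_def by (intro mult_left_mono) auto
  then show ?thesis by simp
qed

theorem theorem1:
  fixes \<psi> :: "real \<Rightarrow> real" and \<beta> a b :: real and p :: ereal and n :: nat
  assumes "class_M_plus_inf \<psi>" and "1 \<le> p" and "n \<ge> 1"
    and "a > 2" and "b > 2"
    and "eta \<psi> (real n) - real n \<ge> a" and "mu \<psi> (real n) \<ge> b"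
  shows "ereal (C_low a * \<psi> (real n) * (eta \<psi> (real n) - real n) powr inv_p p)
           \<le> E_approx n (C_class \<psi> \<beta> p)
       \<and> E_approx n (C_class \<psi> \<beta> p)
           \<le> ereal (C_up a b * \<psi> (real n) * (eta \<psi> (real n) - real n) powr inv_p p)"
proof -
  define m where "m = eta \<psi> n - n"
  have m: "m > 2" and mu: "real n / m > 2" using assms by (auto simp: m_def mu_def)
  interpret psi_at \<psi> n m "m / n"
  proof
    \<comment> \<open>This is \<open>mu \<psi> n > 2\<close> read for the reciprocal.\<close>
    show "m / real n < 1 / 2" using mu m assms(3) by (simp add: field_simps)
  qed (use assms m in \<open>auto simp: class_M_plus_inf_def m_def\<close>)
  have X: "0 \<le> \<psi> n * m powr inv_p p" by (simp add: psi_nonneg)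
  show ?thesis unfolding m_def[symmetric]
  proof
    have "C_low a * \<psi> n * m powr inv_p p \<le> \<psi> n * m powr inv_p p / (64 * pi)"
      using mult_right_mono[OF C_low_le[OF assms(4)] X] by (simp add: mult_ac)
    then show "ereal (C_low a * \<psi> n * m powr inv_p p) \<le> E_approx n (C_class \<psi> \<beta> p)"
      by (intro order_trans[OF _ E_approx_lower[OF assms(2)]]) simp
    have "6 * (1 + pi\<^sup>2) / pi * \<psi> n * m powr inv_p p \<le> C_up a b * \<psi> n * m powr inv_p p"
      using mult_right_mono[OF C_up_ge[OF assms(4,5)] X] by (simp add: mult_ac)
    then show "E_approx n (C_class \<psi> \<beta> p) \<le> ereal (C_up a b * \<psi> n * m powr inv_p p)"
      by (intro order_trans[OF E_approx_upper[OF assms(2)]]) simp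
  qed
qed

end
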